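(* Let $K$ be a complete, algebraically closed nonarchimedean valued field and let $\varphi(z)=(az+b)/(cz+e)\in K(z)$ with $ae-bc\ne0$ (so $\deg\varphi=1$). Then $B_0(\varphi)=1$ and $$\mathrm{Lip}_{\mathrm{Berk}}(\varphi)=\mathrm{Lip}_{\mathbf P^1(K)}(\varphi)=\frac{1}{\mathrm{GIR}(\varphi)}=\frac{1}{\mathrm{GPR}(\varphi)}=\frac{1}{|\mathrm{Res}(\varphi)|}=\frac{\max(|a|,|b|,|c|,|e|)}{|ae-bc|}.$$
   Context: $K$ is a complete, algebraically closed field with a nontrivial nonarchimedean absolute value $|\cdot|$; $\mathcal O=\{|z|\le1\}$, $\mathcal O^\times$ its units. Fix $q>1$, $\log=\log_q$. $\mathbf P^1_{\mathrm{Berk}}$ is the Berkovich projective line over $K$ (a uniquely path-connected tree containing $\mathbf P^1(K)$); $\zeta_{a,r}$ is the point of the disc $D(a,r)=\{z:|z-a|\le r\}$, $\zeta_{a,0}=a$, $\zeta_G=\zeta_{0,1}$; $[x,y]$ the unique path. $\rho$ is the logarithmic path metric on $\mathbf H^1=\mathbf P^1_{\mathrm{Berk}}\setminus\mathbf P^1(K)$ (path $\{\zeta_{a,r}:R_1\le r\le R_2\}$ has length $\log(R_2/R_1)$); $\mathrm{diam}_G(x)=q^{-\rho(\zeta_G,x)}$ on $\mathbf H^1$, $0$ on $\mathbf P^1(K)$, explicitly $\mathrm{diam}_G(\zeta_{a,r})=r/\max(1,|a|,r)^2$. $x\vee_G y$ is the first common point of $[x,\zeta_G]$ and $[y,\zeta_G]$;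 $d(x,y)=2\mathrm{diam}_G(x\vee_G y)-\mathrm{diam}_G(x)-\mathrm{diam}_G(y)$. Spherical metric $\|x,y\|=|x-y|/(\max(1,|x|)\max(1,|y|))$ on $K$, $\|x,\infty\|=1/\max(1,|x|)$. $\mathrm{Lip}_{\mathrm{Berk}}(\varphi)=\sup_{x\ne y\in\mathbf P^1_{\mathrm{Berk}}}d(\varphi x,\varphi y)/d(x,y)$, $\mathrm{Lip}_{\mathbf P^1(K)}(\varphi)=\sup_{x\ne y\in\mathbf P^1(K)}\|\varphi x,\varphi y\|/\|x,y\|$. $\mathrm{GIR}(\varphi)=\mathrm{diam}_G(\varphi(\zeta_G))$; $\mathrm{GPR}(\varphi)=\min\{\mathrm{diam}_G(x):\varphi(x)=\zeta_G\}$. For $a\in\mathbf P^1(K)$, $0<r<1$, $Q_{a,r}$ is the point of $[a,\zeta_G]$ with $\mathrm{diam}_G=r$, $\mathcal B(a,r)^-=\{x:Q_{a,r}\in(x,\zeta_G]\}$, $\mathcal B(a,1)^-=\bigcup_{r<1}\mathcal B(a,r)^-$; $B_0(\varphi)=\sup\{0<r\le1:\varphi(\mathcal B(a,r)^-)\ne\mathbf P^1_{\mathrm{Berk}}\ \forall a\in\mathbf P^1(K)\}$. A normalized representation of $\varphi$ of degree $d$ is a pair of homogeneous $F,G\in\mathcal O[X,Y]$ of degree $d$ without common factor, with some coefficient in $\mathcal O^\times$, with $\varphi([X:Y])=[F:G]$; $|\mathrm{Res}(\varphi)|=|\mathrm{Res}(F,G)|$ (Sylvester resultant), independent of the choice.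
   Formalization: The last expression is corrected to max(|a|,|b|,|c|,|e|)²/|ae−bc|: the printed formula without the square is not invariant under scaling the coefficients (it fails for φ(z)=λz/λ with |λ|≠1) and agrees with the corrected one exactly when the maximum is 1. *)

theory Defs
  imports Complex_Main "HOL-Computational_Algebra.Polynomial"
begin

definition nonarch_abs :: "('a::field \<Rightarrow> real) \<Rightarrow> bool" where
  "nonarch_abs v \<longleftrightarrow> (\<forall>x. 0 \<le> v x) \<and> (\<forall>x. v x = 0 \<longleftrightarrow> x = 0)
     \<and> (\<forall>x y. v (x * y) = v x * v y) \<and> (\<forall>x y. v (x + y) \<le> max (v x) (v y))"

definition nontrivial_abs :: "('a::field \<Rightarrow> real) \<Rightarrow> bool" where
  "nontrivial_abs v \<longleftrightarrow> (\<exists>x. x \<noteq> 0 \<and> v x \<noteq> 1)"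

definition complete_abs :: "('a::field \<Rightarrow> real) \<Rightarrow> bool" where
  "complete_abs v \<longleftrightarrow> (\<forall>X :: nat \<Rightarrow> 'a.
     (\<forall>\<epsilon>>0. \<exists>N. \<forall>m\<ge>N. \<forall>n\<ge>N. v (X m - X n) < \<epsilon>)
       \<longrightarrow> (\<exists>L. \<forall>\<epsilon>>0. \<exists>N. \<forall>n\<ge>N. v (X n - L) < \<epsilon>))"

definition alg_closed_field :: "'a::field itself \<Rightarrow> bool" where
  "alg_closed_field _ \<longleftrightarrow> (\<forall>p :: 'a poly. 1 \<le> degree p \<longrightarrow> (\<exists>x. poly p x = 0))"

definition valued_field_K :: "('a::field \<Rightarrow> real) \<Rightarrow> bool" where
  "valued_field_K v \<longleftrightarrow> nonarch_abs v \<and> nontrivial_abs v \<and> complete_abs v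
     \<and> alg_closed_field TYPE('a)"

text \<open>P^1(K) is \<open>'a option\<close>; \<open>None\<close> is the point \<open>\<infinity>\<close>.\<close>

fun chordal :: "('a::field \<Rightarrow> real) \<Rightarrow> 'a option \<Rightarrow> 'a option \<Rightarrow> real" where
  "chordal v (Some x) (Some y) = v (x - y) / (max 1 (v x) * max 1 (v y))"
| "chordal v (Some x) None = 1 / max 1 (v x)"
| "chordal v None (Some y) = 1 / max 1 (v y)"
| "chordal v None None = 0"

fun mob :: "'a::field \<Rightarrow> 'a \<Rightarrow> 'a \<Rightarrow> 'a \<Rightarrow> 'a option \<Rightarrow> 'a option" where
  "mob a b c e (Some z) = (if c * z + e = 0 then None else Some ((a * z + b) / (c * z + e)))"
| "mob a b c e None = (if c = 0 then None else Some (a / c))"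

definition Lip_P1 :: "('a::field \<Rightarrow> real) \<Rightarrow> 'a \<Rightarrow> 'a \<Rightarrow> 'a \<Rightarrow> 'a \<Rightarrow> real" where
  "Lip_P1 v a b c e = Sup {chordal v (mob a b c e x) (mob a b c e y) / chordal v x y | x y. x \<noteq> y}"

text \<open>Points of the Berkovich affine line: multiplicative seminorms on K[T] extending |.|.\<close>
definition berk_seminorm :: "('a::field \<Rightarrow> real) \<Rightarrow> ('a poly \<Rightarrow> real) \<Rightarrow> bool" where
  "berk_seminorm v s \<longleftrightarrow> (\<forall>f. 0 \<le> s f) \<and> (\<forall>c. s [:c:] = v c)
     \<and> (\<forall>f g. s (f * g) = s f * s g) \<and> (\<forall>f g. s (f + g) \<le> s f + s g)"

datatype 'n berk_ext = BFin 'n | BInf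

type_synonym 'a berk = "('a poly \<Rightarrow> real) berk_ext"

definition P1Berk :: "('a::field \<Rightarrow> real) \<Rightarrow> 'a berk set" where
  "P1Berk v = insert BInf (BFin ` {s. berk_seminorm v s})"

fun typeI :: "('a::field \<Rightarrow> real) \<Rightarrow> 'a option \<Rightarrow> 'a berk" where
  "typeI v (Some a) = BFin (\<lambda>f. v (poly f a))"
| "typeI v None = BInf"

definition zetaG :: "('a::field \<Rightarrow> real) \<Rightarrow> 'a berk" where
  "zetaG v = BFin (\<lambda>f. Max ((\<lambda>i. v (coeff f i)) ` {..degree f}))"

text \<open>Tree partial order rooted at \<infinity> (x below y iff y lies on [x, \<infinity>]).\<close>
fun berk_le :: "'a berk \<Rightarrow> 'a berk \<Rightarrow> bool" where
  "berk_le x BInf = True"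
| "berk_le BInf (BFin t) = False"
| "berk_le (BFin s) (BFin t) = (\<forall>f. s f \<le> t f)"

definition berk_join :: "('a::field \<Rightarrow> real) \<Rightarrow> 'a berk \<Rightarrow> 'a berk \<Rightarrow> 'a berk" where
  "berk_join v x y = (THE z. z \<in> P1Berk v \<and> berk_le x z \<and> berk_le y z
      \<and> (\<forall>w\<in>P1Berk v. berk_le x w \<and> berk_le y w \<longrightarrow> berk_le z w))"

definition seg :: "('a::field \<Rightarrow> real) \<Rightarrow> 'a berk \<Rightarrow> 'a berk \<Rightarrow> 'a berk set" where
  "seg v x y = {z \<in> P1Berk v. (berk_le x z \<and> berk_le z (berk_join v x y))
                            \<or> (berk_le y z \<and> berk_le z (berk_join v x y))}"

definition veeG :: "('a::field \<Rightarrow> real) \<Rightarrow> 'a berk \<Rightarrow> 'a berk \<Rightarrow> 'a berk" where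
  "veeG v x y = (THE w. w \<in> P1Berk v \<and> seg v w (zetaG v) = seg v x (zetaG v) \<inter> seg v y (zetaG v))"

text \<open>diam_G = q^(-rho(zeta_G, x)), written out: for zeta_{a,r}, this is r / max(1,|a|,r)^2;
  in seminorm terms r = inf_a x(T - a) and max(|a|,r) = x(T).\<close>
fun diamG :: "('a::field \<Rightarrow> real) \<Rightarrow> 'a berk \<Rightarrow> real" where
  "diamG v (BFin s) = (INF a. s [:- a, 1:]) / (max 1 (s [:0, 1:]))\<^sup>2"
| "diamG v BInf = 0"

definition berk_d :: "('a::field \<Rightarrow> real) \<Rightarrow> 'a berk \<Rightarrow> 'a berk \<Rightarrow> real" where
  "berk_d v x y = 2 * diamG v (veeG v x y) - diamG v x - diamG v y"

text \<open>Action of the Moebius map on the Berkovich line (pushforward of seminorms: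
  (phi_* s)(f) = s(f o phi), with f o phi = N_f / (cT+e)^(deg f)).\<close>
definition mob_num :: "'a::field \<Rightarrow> 'a \<Rightarrow> 'a \<Rightarrow> 'a \<Rightarrow> 'a poly \<Rightarrow> 'a poly" where
  "mob_num a b c e f = (\<Sum>i\<le>degree f. smult (coeff f i) ([:b, a:] ^ i * [:e, c:] ^ (degree f - i)))"

fun mob_berk :: "('a::field \<Rightarrow> real) \<Rightarrow> 'a \<Rightarrow> 'a \<Rightarrow> 'a \<Rightarrow> 'a \<Rightarrow> 'a berk \<Rightarrow> 'a berk" where
  "mob_berk v a b c e (BFin s) = (if s [:e, c:] = 0 then BInf
       else BFin (\<lambda>f. s (mob_num a b c e f) / s [:e, c:] ^ degree f))"
| "mob_berk v a b c e BInf = (if c = 0 then BInf else BFin (\<lambda>f. v (poly f (a / c))))"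

definition Lip_Berk :: "('a::field \<Rightarrow> real) \<Rightarrow> 'a \<Rightarrow> 'a \<Rightarrow> 'a \<Rightarrow> 'a \<Rightarrow> real" where
  "Lip_Berk v a b c e = Sup {berk_d v (mob_berk v a b c e x) (mob_berk v a b c e y) / berk_d v x y
      | x y. x \<in> P1Berk v \<and> y \<in> P1Berk v \<and> x \<noteq> y}"

definition GIR :: "('a::field \<Rightarrow> real) \<Rightarrow> 'a \<Rightarrow> 'a \<Rightarrow> 'a \<Rightarrow> 'a \<Rightarrow> real" where
  "GIR v a b c e = diamG v (mob_berk v a b c e (zetaG v))"

definition GPR :: "('a::field \<Rightarrow> real) \<Rightarrow> 'a \<Rightarrow> 'a \<Rightarrow> 'a \<Rightarrow> 'a \<Rightarrow> real" where
  "GPR v a b c e = Inf {diamG v x | x. x \<in> P1Berk v \<and> mob_berk v a b c e x = zetaG v}"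

definition Qpt :: "('a::field \<Rightarrow> real) \<Rightarrow> 'a option \<Rightarrow> real \<Rightarrow> 'a berk" where
  "Qpt v a r = (THE p. p \<in> seg v (typeI v a) (zetaG v) \<and> diamG v p = r)"

definition Bminus_lt :: "('a::field \<Rightarrow> real) \<Rightarrow> 'a option \<Rightarrow> real \<Rightarrow> 'a berk set" where
  "Bminus_lt v a r = {x \<in> P1Berk v. Qpt v a r \<in> seg v x (zetaG v) \<and> Qpt v a r \<noteq> x}"

definition Bminus :: "('a::field \<Rightarrow> real) \<Rightarrow> 'a option \<Rightarrow> real \<Rightarrow> 'a berk set" where
  "Bminus v a r = (if r < 1 then Bminus_lt v a r else (\<Union>r'\<in>{0<..<1}. Bminus_lt v a r'))"

definition B0 :: "('a::field \<Rightarrow> real) \<Rightarrow> 'a \<Rightarrow> 'a \<Rightarrow> 'a \<Rightarrow> 'a \<Rightarrow> real" where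
  "B0 v a b c e = Sup {r. 0 < r \<and> r \<le> 1 \<and>
      (\<forall>p. mob_berk v a b c e ` Bminus v p r \<noteq> P1Berk v)}"

text \<open>Sylvester resultant of the linear forms F = a X + b Y, G = c X + e Y:
  the determinant of the Sylvester matrix [[a,b],[c,e]].\<close>
definition sylv_res_lin :: "'a::field \<times> 'a \<times> 'a \<times> 'a \<Rightarrow> 'a" where
  "sylv_res_lin r = (case r of (a, b, c, e) \<Rightarrow> a * e - b * c)"

text \<open>Normalized representation of degree 1 of the map mob a b c e: coefficients in O,
  one of them a unit, no common factor (for linear forms: nonzero resultant), same map.\<close>
definition normalized_rep :: "('a::field \<Rightarrow> real) \<Rightarrow> 'a \<Rightarrow> 'a \<Rightarrow> 'a \<Rightarrow> 'a \<Rightarrow> 'a \<times> 'a \<times> 'a \<times> 'a \<Rightarrow> bool" where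
  "normalized_rep v a b c e r = (case r of (a', b', c', e') \<Rightarrow>
      v a' \<le> 1 \<and> v b' \<le> 1 \<and> v c' \<le> 1 \<and> v e' \<le> 1
      \<and> (v a' = 1 \<or> v b' = 1 \<or> v c' = 1 \<or> v e' = 1)
      \<and> sylv_res_lin (a', b', c', e') \<noteq> 0
      \<and> mob a' b' c' e' = mob a b c e)"

definition abs_Res :: "('a::field \<Rightarrow> real) \<Rightarrow> 'a \<Rightarrow> 'a \<Rightarrow> 'a \<Rightarrow> 'a \<Rightarrow> real" where
  "abs_Res v a b c e = v (sylv_res_lin (SOME r. normalized_rep v a b c e r))"

end

theory Submission
  imports Defs
begin

text \<open>Restricting a point of the Berkovich line to linear forms \<open>uX + wY\<close> identifies it with an
  ultrametric seminorm \<open>N\<close> on \<open>K\<^sup>2\<close>, normalized by \<open>max (N X) (N Y) = 1\<close>. In this picture the Gauss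
  point is the maximum norm, the tree rooted at it is ordered pointwise, joins are pointwise maxima,
  and \<open>diam\<^sub>G\<close> is the infimum of \<open>N\<close> over forms of norm 1, equivalently the infimum of
  \<open>N l * N l'\<close> over pairs with determinant of absolute value 1. The matrix \<open>A\<close> of the Moebius map
  acts by \<open>N l \<mapsto> N (A\<^sup>T l) / C\<close> with \<open>C \<ge> |det A| / |A|\<close>, so it multiplies \<open>diam\<^sub>G\<close> by
  \<open>|det A| / C\<^sup>2\<close>. The points above \<open>N\<close> are the seminorms \<open>max N (t |.|)\<close>, and along this path the
  Lipschitz bound \<open>|A|\<^sup>2 / |det A|\<close> is explicit; it is attained on \<open>P\<^sup>1(K)\<close>. Finally \<open>B\<^sub>0 = 1\<close>
  because no open ball contains the Gauss point and the map is injective.\<close>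

text \<open>The definitions order the tree from infinity, so a path to the Gauss point first climbs
  to a join and then descends; on linear forms the same path is one increasing chain. The obstacle
  is that points need not be discs: \<open>K\<close> may contain nested discs with empty
  intersection. A point is therefore recorded by its values on all \<open>T - a\<close>. These
  determine it, because every polynomial splits into linear factors; conversely, admissible values
  are extended to all polynomials by an infimum of disc seminorms. The square in |A|^2 / |det A| is
  forced: proportional matrices define the same map, so the quotient must have degree 0 in the
  entries. Concretely, each of the two points compared contributes one factor |A|.\<close>

lemma divide_le_max: "0 < m \<Longrightarrow> x \<le> max y z \<Longrightarrow> x / m \<le> max (y / m) (z / m)" for m :: real
  by (auto simp: le_max_iff_disj divide_right_mono)

text \<open>A linear factor disappears under n-th roots. This limit is what turns the triangle
  inequality of \<open>berk_seminorm\<close> into the ultrametric one.\<close>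

lemma le_of_power_le_linear:
  fixes x M :: real
  assumes "0 \<le> M" and le: "\<And>n. x ^ n \<le> (real n + 1) * M ^ n"
  shows "x \<le> M"
proof (rule ccontr)
  assume "\<not> x \<le> M"
  hence lt: "M < x" by simp
  have "M \<noteq> 0" using le[of 1] lt by auto
  hence M: "0 < M" using assms by simp
  define y where "y = x / M"
  have y: "1 < y" using lt M by (simp add: y_def)
  have "y ^ n \<le> real n + 1" for n
    using le[of n] M by (simp add: y_def power_divide field_simps)
  hence *: "1 \<le> real n / y ^ n + (1 / y) ^ n" for n
    using y by (simp add: power_divide field_simps)
  have "(\<lambda>n. real n / y ^ n + (1 / y) ^ n) \<longlonglongrightarrow> 0 + 0"
    using y by (intro tendsto_add lim_n_over_pown LIMSEQ_realpow_zero) auto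
  hence "1 \<le> (0::real)" using * by (intro LIMSEQ_le_const[of _ 0 1]) auto
  thus False by simp
qed

locale valued_field =
  fixes v :: "'a::field \<Rightarrow> real"
  assumes valued: "valued_field_K v"
begin

subsection \<open>The absolute value\<close>

lemma v_nonneg [simp]: "0 \<le> v x"
  and v_eq_0 [simp]: "v x = 0 \<longleftrightarrow> x = 0"
  and v_mult: "v (x * y) = v x * v y"
  and v_add: "v (x + y) \<le> max (v x) (v y)"
  using valued by (auto simp: valued_field_K_def nonarch_abs_def)

lemma v_0 [simp]: "v 0 = 0"
  by simp

lemma v_1 [simp]: "v 1 = 1"
  using v_mult[of 1 1] by (metis mult_cancel_right1 mult.right_neutral v_eq_0 zero_neq_one)

lemma v_pos: "x \<noteq> 0 \<Longrightarrow> 0 < v x"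
  using v_nonneg[of x] v_eq_0[of x] by linarith

lemma v_minus [simp]: "v (- x) = v x"
proof -
  have "v (-1) * v (-1) = 1" using v_mult[of "-1" "-1"] by simp
  hence "v (-1) = 1" using v_nonneg[of "-1"] by (simp add: square_eq_1_iff)
  thus ?thesis using v_mult[of "-1" x] by simp
qed

lemma v_diff: "v (x - y) \<le> max (v x) (v y)"
  using v_add[of x "- y"] by simp

lemma v_minus_commute: "v (x - y) = v (y - x)"
  using v_minus[of "x - y"] by simp

lemma v_inverse: "v (inverse x) = inverse (v x)"
proof (cases "x = 0")
  case False
  hence "v x * v (inverse x) = 1" by (simp flip: v_mult)
  thus ?thesis using False by (simp add: field_simps)
qed simp

lemma v_divide: "v (x / y) = v x / v y"
  by (simp add: divide_inverse v_mult v_inverse)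

lemma v_power: "v (x ^ n) = v x ^ n"
  by (induction n) (auto simp: v_mult)

lemma v_add_eq_max:
  assumes "v y < v x"
  shows "v (x + y) = v x"
  using v_add[of x y] v_diff[of "x + y" y] assms by auto

lemma v_sum_le:
  assumes "\<And>i. i \<in> I \<Longrightarrow> v (f i) \<le> B" "0 \<le> B"
  shows "v (sum f I) \<le> B"
  using assms
proof (induction I rule: infinite_finite_induct)
  case (insert x F)
  thus ?case using v_add[of "f x" "sum f F"] by fastforce
qed auto

lemma v_of_nat: "v (of_nat n) \<le> 1"
proof (induction n)
  case (Suc n)
  thus ?case using v_add[of 1 "of_nat n"] by auto
qed simp

lemma ex_small: "\<exists>t. t \<noteq> 0 \<and> v t < 1"
proof -
  obtain x where x: "x \<noteq> 0" "v x \<noteq> 1"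
    using valued by (auto simp: valued_field_K_def nontrivial_abs_def)
  show ?thesis
  proof (cases "v x < 1")
    case False
    hence "v (inverse x) < 1" using x by (simp add: v_inverse inverse_less_1_iff)
    thus ?thesis using x by (intro exI[of _ "inverse x"]) auto
  qed (use x in auto)
qed

lemma infinite_UNIV_K: "infinite (UNIV :: 'a set)"
proof
  assume fin: "finite (UNIV :: 'a set)"
  obtain t where t: "t \<noteq> 0" "v t < 1" using ex_small by blast
  have "inj (\<lambda>n::nat. t ^ n)"
  proof (rule injI)
    fix m n assume "t ^ m = t ^ n"
    hence "v t ^ m = v t ^ n" by (metis v_power)
    thus "m = n" using t v_pos[of t] by (simp add: power_inject_exp')
  qed
  thus False using fin by (meson finite_subset subset_UNIV range_inj_infinite)
qed

lemma ex_root: "1 \<le> degree (p :: 'a poly) \<Longrightarrow> \<exists>x. poly p x = 0"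
  using valued by (auto simp: valued_field_K_def alg_closed_field_def)

text \<open>Allows identities between numerators of composed functions to be checked away from the
  pole of the Moebius map.\<close>

lemma poly_eqI_cofinite:
  fixes p q :: "'a poly"
  assumes "finite {x. \<not> P x}" "\<And>x. P x \<Longrightarrow> poly p x = poly q x"
  shows "p = q"
proof (rule ccontr)
  assume "p \<noteq> q"
  hence "finite {x. poly (p - q) x = 0}" by (intro poly_roots_finite) auto
  moreover have "UNIV \<subseteq> {x. poly (p - q) x = 0} \<union> {x. \<not> P x}"
    using assms(2) by auto
  ultimately show False using assms(1) infinite_UNIV_K
    by (meson finite_UnI finite_subset)
qed

subsection \<open>Multiplicative seminorms on polynomials\<close>

lemma seminorm_nonneg: "berk_seminorm v s \<Longrightarrow> 0 \<le> s f"
  and seminorm_const: "berk_seminorm v s \<Longrightarrow> s [:c:] = v c"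
  and seminorm_mult: "berk_seminorm v s \<Longrightarrow> s (f * g) = s f * s g"
  and seminorm_triangle: "berk_seminorm v s \<Longrightarrow> s (f + g) \<le> s f + s g"
  by (auto simp: berk_seminorm_def)

lemma seminorm_0: "berk_seminorm v s \<Longrightarrow> s 0 = 0"
  using seminorm_const[of s 0] by simp

lemma seminorm_1: "berk_seminorm v s \<Longrightarrow> s 1 = 1"
  using seminorm_const[of s 1] by (simp add: one_pCons)

lemma seminorm_power: "berk_seminorm v s \<Longrightarrow> s (f ^ n) = s f ^ n"
  by (induction n) (auto simp: seminorm_1 seminorm_mult)

lemma seminorm_smult: "berk_seminorm v s \<Longrightarrow> s (smult c f) = v c * s f"
  using seminorm_mult[of s "[:c:]" f] by (simp add: seminorm_const)

lemma seminorm_sum: "berk_seminorm v s \<Longrightarrow> s (sum f I) \<le> (\<Sum>i\<in>I. s (f i))"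
proof (induction I rule: infinite_finite_induct)
  case (insert x F)
  thus ?case using seminorm_triangle[of s "f x" "sum f F"] by simp
qed (auto simp: seminorm_0)

text \<open>Binomial coefficients have absolute value at most 1, so each of the \<open>n + 1\<close>
  terms of \<open>(f + g) ^ n\<close> is at most the n-th power of the maximum.\<close>

lemma seminorm_ultra:
  assumes s: "berk_seminorm v s"
  shows "s (f + g) \<le> max (s f) (s g)"
proof (rule le_of_power_le_linear)
  let ?M = "max (s f) (s g)"
  show "0 \<le> ?M" using seminorm_nonneg[OF s] by (simp add: le_max_iff_disj)
  fix n
  have "s (f + g) ^ n = s (\<Sum>k\<le>n. of_nat (n choose k) * f ^ k * g ^ (n - k))"
    by (simp add: seminorm_power[OF s, symmetric] binomial_ring)
  also have "\<dots> \<le> (\<Sum>k\<le>n. s (of_nat (n choose k) * f ^ k * g ^ (n - k)))"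
    by (rule seminorm_sum[OF s])
  also have "\<dots> \<le> (\<Sum>k\<le>n. ?M ^ n)"
  proof (rule sum_mono)
    fix k assume k: "k \<in> {..n}"
    have "s (of_nat (n choose k) * f ^ k * g ^ (n - k))
        = v (of_nat (n choose k)) * (s f ^ k * s g ^ (n - k))"
      by (simp add: seminorm_mult[OF s] seminorm_power[OF s] of_nat_poly seminorm_smult[OF s])
    also have "\<dots> \<le> 1 * (?M ^ k * ?M ^ (n - k))"
      by (intro mult_mono v_of_nat power_mono) (auto simp: seminorm_nonneg[OF s] le_max_iff_disj)
    also have "\<dots> = ?M ^ n" using k by (simp flip: power_add)
    finally show "s (of_nat (n choose k) * f ^ k * g ^ (n - k)) \<le> ?M ^ n" .
  qed
  also have "\<dots> = (real n + 1) * ?M ^ n" by simp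
  finally show "s (f + g) ^ n \<le> (real n + 1) * ?M ^ n" .
qed

text \<open>Over an algebraically closed field \<open>f\<close> is a constant times factors
  \<open>T - a\<close>, and both seminorms are multiplicative. Only roots of \<open>f\<close> enter
  the hypothesis; this is what lets a centre be chosen for finitely many polynomials later.\<close>

lemma seminorm_le_of_linear_factors:
  assumes s: "berk_seminorm v s" and t: "berk_seminorm v t"
    and le: "f \<noteq> 0 \<Longrightarrow> (\<And>a. poly f a = 0 \<Longrightarrow> s [:-a, 1:] \<le> t [:-a, 1:])"
  shows "s f \<le> t f"
  using le
proof (induction "degree f" arbitrary: f)
  case 0
  then obtain c where "f = [:c:]" by (metis degree_eq_zeroE)
  thus ?case by (simp add: seminorm_const[OF s] seminorm_const[OF t])
next
  case (Suc n)
  obtain a where a: "poly f a = 0" using ex_root[of f] Suc.hyps(2) by auto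
  then obtain g where g: "f = [:-a, 1:] * g" by (metis poly_eq_0_iff_dvd dvdE)
  have f0: "f \<noteq> 0" using Suc.hyps(2) by auto
  hence "g \<noteq> 0" using g by auto
  hence "degree f = Suc (degree g)" unfolding g by (subst degree_mult_eq) auto
  moreover have "s [:-b, 1:] \<le> t [:-b, 1:]" if "poly g b = 0" for b
    using that g f0 Suc.prems by auto
  ultimately have "s g \<le> t g" using Suc.hyps by simp
  thus ?case unfolding g seminorm_mult[OF s] seminorm_mult[OF t]
    using Suc.prems[OF f0 a] by (intro mult_mono) (auto simp: seminorm_nonneg[OF s] seminorm_nonneg[OF t])
qed

subsection \<open>Disc seminorms\<close>

text \<open>The supremum norm on the disc of radius \<open>R\<close> about 0. At
  \<open>R = 0\<close> the convention \<open>0 ^ 0 = 1\<close> makes it evaluation at 0.\<close>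

definition gauss :: "real \<Rightarrow> 'a poly \<Rightarrow> real" where
  "gauss R f = Max ((\<lambda>i. v (coeff f i) * R ^ i) ` {..degree f})"

lemma gauss_ge: "0 \<le> R \<Longrightarrow> v (coeff f i) * R ^ i \<le> gauss R f"
proof (cases "i \<le> degree f")
  case False
  assume "0 \<le> R"
  hence "0 \<le> v (coeff f 0) * R ^ 0" by simp
  also have "\<dots> \<le> gauss R f" unfolding gauss_def by (intro Max_ge) (auto intro!: image_eqI[of _ _ 0])
  finally show ?thesis using False by (simp add: coeff_eq_0)
qed (auto simp: gauss_def)

lemma gauss_nonneg: "0 \<le> R \<Longrightarrow> 0 \<le> gauss R f"
  using gauss_ge[of R f 0] order_trans[of 0 "v (coeff f 0) * R ^ 0"] by simp

lemma gauss_leI: "(\<And>i. v (coeff f i) * R ^ i \<le> B) \<Longrightarrow> gauss R f \<le> B"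
  unfolding gauss_def by (subst Max_le_iff) auto

lemma gauss_attained: "\<exists>i. gauss R f = v (coeff f i) * R ^ i"
proof -
  have "gauss R f \<in> (\<lambda>i. v (coeff f i) * R ^ i) ` {..degree f}"
    unfolding gauss_def by (intro Max_in) auto
  thus ?thesis by auto
qed

lemma gauss_add_le:
  assumes "0 \<le> R"
  shows "gauss R (f + g) \<le> max (gauss R f) (gauss R g)"
proof (rule gauss_leI)
  fix i
  have "v (coeff (f + g) i) * R ^ i \<le> max (v (coeff f i)) (v (coeff g i)) * R ^ i"
    using assms by (intro mult_right_mono) (auto simp: v_add)
  also have "\<dots> \<le> max (gauss R f) (gauss R g)"
    using gauss_ge[OF assms, of f i] gauss_ge[OF assms, of g i] by (auto simp: max_def)
  finally show "v (coeff (f + g) i) * R ^ i \<le> max (gauss R f) (gauss R g)" .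
qed

lemma gauss_mult_le:
  assumes R: "0 \<le> R"
  shows "gauss R (f * g) \<le> gauss R f * gauss R g"
proof (rule gauss_leI)
  fix n
  have nn: "0 \<le> gauss R f * gauss R g" by (simp add: gauss_nonneg R)
  show "v (coeff (f * g) n) * R ^ n \<le> gauss R f * gauss R g"
  proof (cases "R ^ n = 0")
    case False
    hence Rn: "0 < R ^ n" using R by (metis zero_le_power order_less_le)
    have "v (coeff f k * coeff g (n - k)) \<le> gauss R f * gauss R g / R ^ n" if "k \<in> {..n}" for k
    proof -
      have "v (coeff f k * coeff g (n - k)) * R ^ n
          = (v (coeff f k) * R ^ k) * (v (coeff g (n - k)) * R ^ (n - k))"
        using that by (simp add: v_mult power_add[symmetric] mult_ac)
      also have "\<dots> \<le> gauss R f * gauss R g"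
        by (intro mult_mono gauss_ge gauss_nonneg R) (use R in auto)
      finally show ?thesis using Rn by (simp add: field_simps)
    qed
    hence "v (coeff (f * g) n) \<le> gauss R f * gauss R g / R ^ n"
      unfolding coeff_mult using Rn nn by (intro v_sum_le) auto
    thus ?thesis using Rn by (simp add: field_simps)
  qed (use nn in \<open>simp only: mult_zero_right\<close>)
qed

text \<open>Gauss's lemma. With \<open>i\<close>, \<open>j\<close> the least indices attaining the
  two maxima, every other term of coefficient \<open>i + j\<close> of the product has an index below
  \<open>i\<close> or below \<open>j\<close>, hence is strictly smaller, so the term of
  \<open>i\<close> and \<open>j\<close> alone decides the absolute value.\<close>

lemma gauss_mult_ge:
  assumes R: "0 \<le> R"
  shows "gauss R f * gauss R g \<le> gauss R (f * g)"
proof (cases "gauss R f = 0 \<or> gauss R g = 0")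
  case True
  thus ?thesis using gauss_nonneg[OF R, of "f * g"] by auto
next
  case False
  hence M: "0 < gauss R f" "0 < gauss R g"
    using gauss_nonneg[OF R, of f] gauss_nonneg[OF R, of g] by auto
  define i where "i = (LEAST i. gauss R f = v (coeff f i) * R ^ i)"
  define j where "j = (LEAST j. gauss R g = v (coeff g j) * R ^ j)"
  have i: "gauss R f = v (coeff f i) * R ^ i"
    unfolding i_def using gauss_attained by (rule LeastI_ex)
  have j: "gauss R g = v (coeff g j) * R ^ j"
    unfolding j_def using gauss_attained by (rule LeastI_ex)
  have li: "v (coeff f k) * R ^ k < gauss R f" if "k < i" for k
    using not_less_Least[OF that[unfolded i_def]] gauss_ge[OF R, of f k] by auto
  have lj: "v (coeff g k) * R ^ k < gauss R g" if "k < j" for k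
    using not_less_Least[OF that[unfolded j_def]] gauss_ge[OF R, of g k] by auto
  define n where "n = i + j"
  have "R ^ i \<noteq> 0" "R ^ j \<noteq> 0" using M i j by (metis mult_zero_right less_irrefl)+
  hence "R ^ n \<noteq> 0" by (simp add: n_def power_add)
  hence Rn: "0 < R ^ n" using R by (metis zero_le_power order_less_le)
  have lead: "v (coeff f i * coeff g j) * R ^ n = gauss R f * gauss R g"
    by (simp add: i j v_mult n_def power_add mult_ac)
  define rest where "rest = (\<Sum>k\<in>{..n} - {i}. coeff f k * coeff g (n - k))"
  have split: "coeff (f * g) n = coeff f i * coeff g j + rest"
    unfolding coeff_mult rest_def by (subst sum.remove[of _ i]) (auto simp: n_def)
  have small: "v (coeff f k * coeff g (n - k)) < v (coeff f i * coeff g j)" if "k \<in> {..n} - {i}" for k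
  proof -
    have "v (coeff f k * coeff g (n - k)) * R ^ n
        = (v (coeff f k) * R ^ k) * (v (coeff g (n - k)) * R ^ (n - k))"
      using that by (simp add: v_mult power_add[symmetric] mult_ac)
    also have "\<dots> < gauss R f * gauss R g"
    proof (cases "k < i")
      case True
      have "(v (coeff f k) * R ^ k) * (v (coeff g (n - k)) * R ^ (n - k))
          \<le> (v (coeff f k) * R ^ k) * gauss R g"
        using R by (intro mult_left_mono gauss_ge) auto
      also have "\<dots> < gauss R f * gauss R g" using li[OF True] M by simp
      finally show ?thesis .
    next
      case False
      hence "n - k < j" using that by (auto simp: n_def)
      from lj[OF this] have "gauss R f * (v (coeff g (n - k)) * R ^ (n - k)) < gauss R f * gauss R g"
        using M by simp
      moreover have "(v (coeff f k) * R ^ k) * (v (coeff g (n - k)) * R ^ (n - k))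
          \<le> gauss R f * (v (coeff g (n - k)) * R ^ (n - k))"
        using R by (intro mult_right_mono gauss_ge) auto
      ultimately show ?thesis by linarith
    qed
    finally show ?thesis unfolding lead[symmetric] using Rn by simp
  qed
  have "v rest < v (coeff f i * coeff g j)"
  proof (cases "{..n} - {i} = {}")
    case True
    have "0 < v (coeff f i * coeff g j)" using M i j by (intro v_pos) auto
    thus ?thesis unfolding rest_def True by simp
  next
    case False
    let ?B = "Max ((\<lambda>k. v (coeff f k * coeff g (n - k))) ` ({..n} - {i}))"
    obtain k where k: "k \<in> {..n} - {i}" using False by blast
    have "v (coeff f k * coeff g (n - k)) \<le> ?B" using k by (intro Max_ge) auto
    hence "0 \<le> ?B" using v_nonneg order_trans by blast
    hence "v rest \<le> ?B" unfolding rest_def by (intro v_sum_le) (auto intro!: Max_ge)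
    also have "?B < v (coeff f i * coeff g j)" using False small by (subst Max_less_iff) auto
    finally show ?thesis .
  qed
  hence "v (coeff (f * g) n) = v (coeff f i * coeff g j)" unfolding split by (rule v_add_eq_max)
  thus ?thesis using gauss_ge[OF R, of "f * g" n] lead by simp
qed

definition disc :: "'a \<Rightarrow> real \<Rightarrow> 'a poly \<Rightarrow> real" where
  "disc b R f = gauss R (pcompose f [:b, 1:])"

lemma disc_seminorm:
  assumes "0 \<le> R"
  shows "berk_seminorm v (disc b R)"
  unfolding berk_seminorm_def disc_def
proof (intro conjI allI)
  fix f g
  show "0 \<le> gauss R (f \<circ>\<^sub>p [:b, 1:])" by (rule gauss_nonneg[OF assms])
  show "gauss R ((f * g) \<circ>\<^sub>p [:b, 1:]) = gauss R (f \<circ>\<^sub>p [:b, 1:]) * gauss R (g \<circ>\<^sub>p [:b, 1:])"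
    unfolding pcompose_mult by (intro antisym gauss_mult_le gauss_mult_ge assms)
  have "gauss R (f \<circ>\<^sub>p [:b, 1:] + g \<circ>\<^sub>p [:b, 1:])
      \<le> max (gauss R (f \<circ>\<^sub>p [:b, 1:])) (gauss R (g \<circ>\<^sub>p [:b, 1:]))"
    by (rule gauss_add_le[OF assms])
  also have "\<dots> \<le> gauss R (f \<circ>\<^sub>p [:b, 1:]) + gauss R (g \<circ>\<^sub>p [:b, 1:])"
    using gauss_nonneg[OF assms] by simp
  finally show "gauss R ((f + g) \<circ>\<^sub>p [:b, 1:]) \<le> gauss R (f \<circ>\<^sub>p [:b, 1:]) + gauss R (g \<circ>\<^sub>p [:b, 1:])"
    by (simp add: pcompose_add)
qed (simp add: gauss_def)

lemma disc_linear: "disc b R [:-a, 1:] = max (v (b - a)) R"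
proof -
  have "disc b R [:-a, 1:] = gauss R [:b - a, 1:]"
    by (simp add: disc_def pcompose_pCons)
  also have "\<dots> = max (v (b - a)) R" by (simp add: gauss_def atMost_Suc max.commute)
  finally show ?thesis .
qed

subsection \<open>Extending a radius function to a point\<close>

text \<open>Models \<open>a \<mapsto> s (T - a)\<close>, the radius of the smallest disc about
  \<open>a\<close> containing the point. The inequalities are the ultrametric ones between
  \<open>T - a\<close>, \<open>T - b\<close> and the constant \<open>a - b\<close>.\<close>

definition radius_fun :: "('a \<Rightarrow> real) \<Rightarrow> bool" where
  "radius_fun \<rho> \<longleftrightarrow> (\<forall>a. 0 \<le> \<rho> a) \<and> (\<forall>a b. \<rho> a \<le> max (\<rho> b) (v (a - b)))
     \<and> (\<forall>a b. v (a - b) \<le> max (\<rho> a) (\<rho> b))"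

text \<open>The infimum is needed because no single disc has to serve all polynomials at once: this
  is the case of nested discs with empty intersection.\<close>

definition radius_ext :: "('a \<Rightarrow> real) \<Rightarrow> 'a poly \<Rightarrow> real" where
  "radius_ext \<rho> f = (INF b. disc b (\<rho> b) f)"

text \<open>For a root \<open>a\<close>, minimality gives
  \<open>max (v (b - a)) (\<rho> b) \<le> \<rho> a\<close>, and \<open>\<rho> a\<close> is at most
  the value of any disc seminorm of the family at \<open>T - a\<close>.\<close>

lemma disc_minimal:
  assumes \<rho>: "radius_fun \<rho>" and b: "f \<noteq> 0 \<Longrightarrow> (\<And>a. poly f a = 0 \<Longrightarrow> \<rho> b \<le> \<rho> a)"
  shows "disc b (\<rho> b) f \<le> disc b' (\<rho> b') f"
proof (rule seminorm_le_of_linear_factors)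
  fix a assume "f \<noteq> 0" "poly f a = 0"
  hence "\<rho> b \<le> \<rho> a" using b by blast
  moreover have "v (b - a) \<le> max (\<rho> b) (\<rho> a)" "\<rho> a \<le> max (\<rho> b') (v (a - b'))"
    using \<rho> by (auto simp: radius_fun_def)
  ultimately show "disc b (\<rho> b) [:-a, 1:] \<le> disc b' (\<rho> b') [:-a, 1:]"
    unfolding disc_linear using v_minus_commute[of a b'] by auto
qed (use \<rho> in \<open>auto simp: radius_fun_def intro: disc_seminorm\<close>)

text \<open>A centre of minimal radius among the roots of finitely many polynomials computes the
  infimum for all of them, so on finitely many polynomials the extension is a disc seminorm.\<close>

lemma radius_ext_eq_disc:
  assumes \<rho>: "radius_fun \<rho>" and F: "finite F"
  shows "\<exists>b. \<forall>f\<in>F. radius_ext \<rho> f = disc b (\<rho> b) f"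
proof -
  \<comment> \<open>The point 0 only makes the set nonempty. The zero polynomial is left out because
    all of \<open>K\<close> would be roots of it.\<close>
  define A where "A = insert 0 (\<Union>f\<in>F - {0}. {a. poly f a = 0})"
  have "finite A" unfolding A_def using F poly_roots_finite by auto
  moreover have "A \<noteq> {}" by (auto simp: A_def)
  ultimately obtain b where b: "b \<in> A" "\<forall>a\<in>A. \<rho> b \<le> \<rho> a"
    by (meson finite_has_minimal2 arg_min_if_finite(1) arg_min_least)
  have "radius_ext \<rho> f = disc b (\<rho> b) f" if f: "f \<in> F" for f
  proof -
    have "disc b (\<rho> b) f \<le> disc b' (\<rho> b') f" for b'
      using f b by (intro disc_minimal[OF \<rho>]) (auto simp: A_def)
    thus ?thesis unfolding radius_ext_def
      by (intro cInf_eq_minimum) auto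
  qed
  thus ?thesis by blast
qed

lemma radius_ext_seminorm:
  assumes \<rho>: "radius_fun \<rho>"
  shows "berk_seminorm v (radius_ext \<rho>)"
proof -
  have s: "berk_seminorm v (disc b (\<rho> b))" for b
    using \<rho> by (intro disc_seminorm) (auto simp: radius_fun_def)
  show ?thesis unfolding berk_seminorm_def
  proof (intro conjI allI)
    fix f g c
    \<comment> \<open>Each axiom involves only these polynomials, so it is inherited from a single
      disc seminorm.\<close>
    obtain b where b: "\<forall>h\<in>{f, g, f + g, f * g, [:c:]}. radius_ext \<rho> h = disc b (\<rho> b) h"
      using radius_ext_eq_disc[OF \<rho>, of "{f, g, f + g, f * g, [:c:]}"] by auto
    show "0 \<le> radius_ext \<rho> f" "radius_ext \<rho> [:c:] = v c"
      "radius_ext \<rho> (f * g) = radius_ext \<rho> f * radius_ext \<rho> g"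
      "radius_ext \<rho> (f + g) \<le> radius_ext \<rho> f + radius_ext \<rho> g"
      using b seminorm_nonneg[OF s] seminorm_const[OF s] seminorm_mult[OF s] seminorm_triangle[OF s]
      by simp_all
  qed
qed

lemma radius_ext_linear:
  assumes \<rho>: "radius_fun \<rho>"
  shows "radius_ext \<rho> [:-a, 1:] = \<rho> a"
  unfolding radius_ext_def
proof (rule cInf_eq_minimum)
  have "0 \<le> \<rho> a" using \<rho> by (auto simp: radius_fun_def)
  thus "\<rho> a \<in> range (\<lambda>b. disc b (\<rho> b) [:-a, 1:])"
    by (intro image_eqI[of _ _ a]) (auto simp: disc_linear)
  fix x assume "x \<in> range (\<lambda>b. disc b (\<rho> b) [:-a, 1:])"
  then obtain b where "x = max (v (b - a)) (\<rho> b)" by (auto simp: disc_linear)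
  moreover have "\<rho> a \<le> max (\<rho> b) (v (a - b))" using \<rho> by (auto simp: radius_fun_def)
  ultimately show "\<rho> a \<le> x" using v_minus_commute[of a b] by auto
qed

lemma seminorm_radius_fun:
  assumes s: "berk_seminorm v s"
  shows "radius_fun (\<lambda>a. s [:-a, 1:])"
  unfolding radius_fun_def
proof (intro conjI allI)
  fix a b
  show "0 \<le> s [:-a, 1:]" by (rule seminorm_nonneg[OF s])
  show "s [:-a, 1:] \<le> max (s [:-b, 1:]) (v (a - b))"
    using seminorm_ultra[OF s, of "[:-b, 1:]" "[:b - a:]"] v_minus_commute[of a b]
    by (simp add: seminorm_const[OF s])
  have "s [:a - b:] \<le> max (s [:-b, 1:]) (s (smult (-1) [:-a, 1:]))"
    using seminorm_ultra[OF s, of "[:-b, 1:]" "smult (-1) [:-a, 1:]"] by simp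
  thus "v (a - b) \<le> max (s [:-a, 1:]) (s [:-b, 1:])"
    unfolding seminorm_smult[OF s] seminorm_const[OF s] by (simp add: max.commute)
qed

lemma seminorm_eqI:
  assumes s: "berk_seminorm v s" and t: "berk_seminorm v t"
    and eq: "\<And>a. s [:-a, 1:] = t [:-a, 1:]"
  shows "s = t"
  using seminorm_le_of_linear_factors[OF s t] seminorm_le_of_linear_factors[OF t s] eq
  by (intro ext antisym) auto

subsection \<open>Normalized seminorms on linear forms\<close>

text \<open>Nonzero forms may have value 0, which happens exactly at the points of
  \<open>P\<^sup>1(K)\<close>. The last conjunct picks one seminorm from each class under
  scaling.\<close>

definition unit_seminorm :: "('a \<Rightarrow> 'a \<Rightarrow> real) \<Rightarrow> bool" where
  "unit_seminorm N \<longleftrightarrow> (\<forall>u w. 0 \<le> N u w) \<and> (\<forall>k u w. N (k * u) (k * w) = v k * N u w)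
     \<and> (\<forall>u w u' w'. N (u + u') (w + w') \<le> max (N u w) (N u' w')) \<and> max (N 1 0) (N 0 1) = 1"

lemma unit_nonneg: "unit_seminorm N \<Longrightarrow> 0 \<le> N u w"
  and unit_scale: "unit_seminorm N \<Longrightarrow> N (k * u) (k * w) = v k * N u w"
  and unit_add: "unit_seminorm N \<Longrightarrow> N (u + u') (w + w') \<le> max (N u w) (N u' w')"
  and unit_max: "unit_seminorm N \<Longrightarrow> max (N 1 0) (N 0 1) = 1"
  by (auto simp: unit_seminorm_def)

lemma unit_0: "unit_seminorm N \<Longrightarrow> N 0 0 = 0"
  using unit_scale[of N 0 0 0] by simp

lemma unit_uminus: "unit_seminorm N \<Longrightarrow> N (- u) (- w) = N u w"
  using unit_scale[of N "-1" u w] by simp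

lemma unit_diff: "unit_seminorm N \<Longrightarrow> N (u - u') (w - w') \<le> max (N u w) (N u' w')"
  using unit_add[of N u "-u'" w "-w'"] by (simp add: unit_uminus)

lemma unit_axes: "unit_seminorm N \<Longrightarrow> N u 0 = v u * N 1 0" "unit_seminorm N \<Longrightarrow> N 0 w = v w * N 0 1"
  using unit_scale[of N u 1 0] unit_scale[of N w 0 1] by simp_all

lemma unit_le:
  assumes N: "unit_seminorm N"
  shows "N u w \<le> max (v u) (v w)"
proof -
  have "N u w \<le> max (v u * N 1 0) (v w * N 0 1)"
    using unit_add[OF N, of u 0 0 w] unit_axes(1)[OF N, of u] unit_axes(2)[OF N, of w] by simp
  also have "\<dots> \<le> max (v u * 1) (v w * 1)"
    using unit_max[OF N] by (intro max.mono mult_left_mono) auto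
  finally show ?thesis by simp
qed

text \<open>Cramer's rule: both coordinate forms, multiplied by the determinant, are combinations of
  the two given forms.\<close>

lemma det_le_comb:
  assumes N: "unit_seminorm N"
  shows "v (u * w' - u' * w) \<le> max (max (v u') (v w') * N u w) (max (v u) (v w) * N u' w')"
    (is "v ?d \<le> ?B")
proof -
  have "v ?d * N 1 0 = N (w' * u - w * u') (w' * w - w * w')"
    using unit_axes(1)[OF N, of ?d] by (simp add: mult.commute)
  also have "\<dots> \<le> max (v w' * N u w) (v w * N u' w')"
    unfolding unit_scale[OF N, symmetric] by (rule unit_diff[OF N])
  also have "\<dots> \<le> ?B"
    using unit_nonneg[OF N] by (intro max.mono mult_right_mono) auto
  finally have 1: "v ?d * N 1 0 \<le> ?B" .
  have "v ?d * N 0 1 = N (u * u' - u' * u) (u * w' - u' * w)"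
    using unit_axes(2)[OF N, of ?d] by (simp add: mult.commute)
  also have "\<dots> \<le> max (v u * N u' w') (v u' * N u w)"
    unfolding unit_scale[OF N, symmetric] by (rule unit_diff[OF N])
  also have "\<dots> \<le> max (max (v u) (v w) * N u' w') (max (v u') (v w') * N u w)"
    using unit_nonneg[OF N] by (intro max.mono mult_right_mono) auto
  finally have 2: "v ?d * N 0 1 \<le> ?B" by (simp add: max.commute)
  from 1 2 unit_max[OF N] show ?thesis by (auto simp: max_def split: if_splits)
qed

lemma unit_seminorm_sup:
  assumes N: "unit_seminorm N" and M: "unit_seminorm M"
  shows "unit_seminorm (\<lambda>u w. max (N u w) (M u w))"
  unfolding unit_seminorm_def
proof (intro conjI allI)
  fix k u w u' w'
  show "0 \<le> max (N u w) (M u w)" by (simp add: le_max_iff_disj unit_nonneg[OF N])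
  show "max (N (k * u) (k * w)) (M (k * u) (k * w)) = v k * max (N u w) (M u w)"
    by (simp add: unit_scale[OF N] unit_scale[OF M] max_mult_distrib_left)
  show "max (N (u + u') (w + w')) (M (u + u') (w + w'))
      \<le> max (max (N u w) (M u w)) (max (N u' w') (M u' w'))"
    using unit_add[OF N, of u u' w w'] unit_add[OF M, of u u' w w'] by auto
qed (use unit_max[OF N] unit_max[OF M] in auto)

lemma unit_seminorm_std: "unit_seminorm (\<lambda>u w. max (v u) (v w))"
  unfolding unit_seminorm_def
proof (intro conjI allI)
  fix k u w u' w'
  show "max (v (k * u)) (v (k * w)) = v k * max (v u) (v w)"
    by (simp add: v_mult max_mult_distrib_left)
  show "max (v (u + u')) (v (w + w')) \<le> max (max (v u) (v w)) (max (v u') (v w'))"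
    using v_add[of u u'] v_add[of w w'] by auto
qed (auto simp: le_max_iff_disj)

section \<open>Thickenings and the diameter\<close>

definition thicken :: "('a \<Rightarrow> 'a \<Rightarrow> real) \<Rightarrow> real \<Rightarrow> 'a \<Rightarrow> 'a \<Rightarrow> real" where
  "thicken N t u w = max (N u w) (t * max (v u) (v w))"

lemma unit_seminorm_thicken:
  assumes N: "unit_seminorm N" and t: "0 \<le> t" "t \<le> 1"
  shows "unit_seminorm (thicken N t)"
  unfolding unit_seminorm_def thicken_def
proof (intro conjI allI)
  fix k u w u' w'
  show "0 \<le> max (N u w) (t * max (v u) (v w))" by (simp add: le_max_iff_disj unit_nonneg[OF N])
  show "max (N (k * u) (k * w)) (t * max (v (k * u)) (v (k * w))) = v k * max (N u w) (t * max (v u) (v w))"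
    unfolding unit_scale[OF N] unit_scale[OF unit_seminorm_std]
    by (simp add: max_mult_distrib_left[of "v k"] mult.left_commute)
  have "t * max (v (u + u')) (v (w + w')) \<le> t * max (max (v u) (v w)) (max (v u') (v w'))"
    using unit_add[OF unit_seminorm_std] t by (intro mult_left_mono) auto
  also have "\<dots> = max (t * max (v u) (v w)) (t * max (v u') (v w'))"
    using t by (simp add: max_mult_distrib_left)
  finally show "max (N (u + u') (w + w')) (t * max (v (u + u')) (v (w + w')))
      \<le> max (max (N u w) (t * max (v u) (v w))) (max (N u' w') (t * max (v u') (v w')))"
    using unit_add[OF N, of u u' w w'] by linarith
  show "max (max (N 1 0) (t * max (v 1) (v 0))) (max (N 0 1) (t * max (v 0) (v 1))) = 1"
    using unit_max[OF N] t by auto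
qed

definition ndiam :: "('a \<Rightarrow> 'a \<Rightarrow> real) \<Rightarrow> real" where
  "ndiam N = Inf {N u w | u w. max (v u) (v w) = 1}"

lemma ndiam_le:
  assumes N: "unit_seminorm N" and "max (v u) (v w) = 1"
  shows "ndiam N \<le> N u w"
  unfolding ndiam_def using assms unit_nonneg[OF N]
  by (intro cInf_lower) (auto intro!: bdd_belowI[of _ 0])

lemma ndiam_ge: "(\<And>u w. max (v u) (v w) = 1 \<Longrightarrow> B \<le> N u w) \<Longrightarrow> B \<le> ndiam N"
  unfolding ndiam_def by (intro cInf_greatest) (auto intro!: exI[of _ 1])

lemma ndiam_nonneg: "unit_seminorm N \<Longrightarrow> 0 \<le> ndiam N"
  by (intro ndiam_ge unit_nonneg)

lemma ndiam_le_1: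
  assumes N: "unit_seminorm N"
  shows "ndiam N \<le> 1"
proof -
  have "ndiam N \<le> N 1 0" by (rule ndiam_le[OF N]) simp
  also have "\<dots> \<le> 1" using unit_max[OF N] by auto
  finally show ?thesis .
qed

lemma ex_unit_multiple:
  assumes "u \<noteq> 0 \<or> w \<noteq> 0"
  shows "\<exists>k. k \<noteq> 0 \<and> v k = max (v u) (v w) \<and> max (v (u / k)) (v (w / k)) = 1"
proof (cases "v u \<le> v w")
  case True
  hence "w \<noteq> 0" using assms v_pos[of u] by auto
  with True show ?thesis by (intro exI[of _ w]) (auto simp: v_divide max_def field_simps v_pos)
next
  case False
  hence "u \<noteq> 0" by auto
  with False show ?thesis by (intro exI[of _ u]) (auto simp: v_divide max_def field_simps v_pos)
qed

lemma ndiam_mult_le: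
  assumes N: "unit_seminorm N"
  shows "ndiam N * max (v u) (v w) \<le> N u w"
proof (cases "u = 0 \<and> w = 0")
  case False
  then obtain k where k: "k \<noteq> 0" "v k = max (v u) (v w)" "max (v (u / k)) (v (w / k)) = 1"
    using ex_unit_multiple[of u w] by auto
  have "v k * ndiam N \<le> v k * N (u / k) (w / k)" using ndiam_le[OF N k(3)] by (intro mult_left_mono) auto
  also have "\<dots> = N u w" unfolding unit_scale[OF N, symmetric] using k by simp
  finally show ?thesis using k by (simp add: mult.commute)
qed (simp add: unit_0[OF N])

lemma ndiam_mono:
  assumes N: "unit_seminorm N" and le: "\<And>u w. N u w \<le> M u w"
  shows "ndiam N \<le> ndiam M"
  using ndiam_le[OF N] le by (intro ndiam_ge) (meson order_trans)

lemma ndiam_std: "ndiam (\<lambda>u w. max (v u) (v w)) = 1"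
  by (intro antisym ndiam_le_1 unit_seminorm_std ndiam_ge) auto

lemma ndiam_thicken:
  assumes N: "unit_seminorm N" and t: "0 \<le> t" "t \<le> 1"
  shows "ndiam (thicken N t) = max (ndiam N) t"
proof (rule antisym)
  note T = unit_seminorm_thicken[OF N t]
  show "max (ndiam N) t \<le> ndiam (thicken N t)"
    by (rule ndiam_ge) (auto simp: thicken_def dest: ndiam_le[OF N])
  show "ndiam (thicken N t) \<le> max (ndiam N) t"
  \<comment> \<open>Above \<open>t\<close>, the value of the thickening on a unit form can only come
    from \<open>N\<close>.\<close>
  proof (cases "ndiam (thicken N t) \<le> t")
    case False
    have "ndiam (thicken N t) \<le> ndiam N"
    proof (rule ndiam_ge)
      fix u w assume u: "max (v u) (v w) = 1"
      show "ndiam (thicken N t) \<le> N u w"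
        using ndiam_le[OF T u] False u by (auto simp: thicken_def)
    qed
    thus ?thesis by simp
  qed auto
qed

text \<open>A coordinate form of norm 1 and a form with smaller norm are a unimodular basis; in it, the
  norm of the form in question is the one of its first component, on which both seminorms agree.\<close>

lemma unit_eq_above_smaller:
  assumes N: "unit_seminorm N" and M: "unit_seminorm M" and le: "\<And>u w. N u w \<le> M u w"
    and l: "max (v u) (v w) = 1" and l0: "max (v u0) (v w0) = 1" and lt: "M u0 w0 < M u w"
  shows "N u w = M u w"
proof -
  have M1: "M u0 w0 < 1" using lt unit_le[OF M, of u w] l by simp
  have key: "N u w = M u w"
    if e: "N p r = 1" "max (v p) (v r) = 1" "u = \<alpha> * p + \<beta> * u0" "w = \<alpha> * r + \<beta> * w0" "v \<beta> \<le> 1"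
    for p r \<alpha> \<beta>
  proof -
    have Mp: "M p r = 1" using le[of p r] unit_le[OF M, of p r] e by simp
    have "M (\<beta> * u0) (\<beta> * w0) \<le> 1 * M u0 w0"
      unfolding unit_scale[OF M] using e unit_nonneg[OF M] by (intro mult_right_mono) auto
    hence bM: "M (\<beta> * u0) (\<beta> * w0) < M u w" using lt by simp
    hence bN: "N (\<beta> * u0) (\<beta> * w0) < M u w" using le[of "\<beta> * u0" "\<beta> * w0"] by simp
    have ea: "\<alpha> * p = u - \<beta> * u0" "\<alpha> * r = w - \<beta> * w0" using e by auto
    have "M u w \<le> max (v \<alpha> * 1) (M (\<beta> * u0) (\<beta> * w0))"
      using unit_add[OF M, of "\<alpha> * p" "\<beta> * u0" "\<alpha> * r" "\<beta> * w0"] e Mp by (simp add: unit_scale[OF M])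
    hence "M u w \<le> v \<alpha>" using bM by auto
    moreover have "v \<alpha> \<le> max (N u w) (N (\<beta> * u0) (\<beta> * w0))"
      using unit_diff[OF N, of u "\<beta> * u0" w "\<beta> * w0"] e(1) by (simp add: ea[symmetric] unit_scale[OF N])
    ultimately show ?thesis using bN le[of u w] by auto
  qed
  from unit_max[OF N] consider "N 1 0 = 1" | "N 0 1 = 1" by (auto simp: max_def split: if_splits)
  thus ?thesis
  proof cases
    case 1
    have Mp: "M 1 0 = 1" using le[of 1 0] unit_le[OF M, of 1 0] 1 by simp
    \<comment> \<open>The determinant of the forms \<open>(1, 0)\<close> and \<open>(u0, w0)\<close>
      is \<open>w0\<close>. If it were not a unit, \<open>M 1 0 = 1\<close> would force
      \<open>M u0 w0 = 1\<close>.\<close>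
    have w0: "v w0 = 1"
    proof (rule ccontr)
      assume w0: "v w0 \<noteq> 1"
      hence w1: "v w0 < 1" "v u0 = 1" using l0 by (auto simp: max_def split: if_splits)
      have "M u0 0 \<le> max (M u0 w0) (M 0 w0)" using unit_diff[OF M, of u0 0 w0 w0] by simp
      moreover have "M 0 w0 < 1" using unit_le[OF M, of 0 w0] w1 v_nonneg[of w0] by simp
      ultimately show False using unit_axes(1)[OF M, of u0] Mp w1 M1 by auto
    qed
    hence "w0 \<noteq> 0" by auto
    show ?thesis
      by (rule key[of 1 0 "u - w / w0 * u0" "w / w0"])
        (use 1 w0 \<open>w0 \<noteq> 0\<close> l in \<open>auto simp: v_divide\<close>)
  next
    case 2
    have Mp: "M 0 1 = 1" using le[of 0 1] unit_le[OF M, of 0 1] 2 by simp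
    have u0: "v u0 = 1"
    proof (rule ccontr)
      assume u0: "v u0 \<noteq> 1"
      hence w1: "v u0 < 1" "v w0 = 1" using l0 by (auto simp: max_def split: if_splits)
      have "M 0 w0 \<le> max (M u0 w0) (M u0 0)" using unit_diff[OF M, of u0 u0 w0 0] by simp
      moreover have "M u0 0 < 1" using unit_le[OF M, of u0 0] w1 v_nonneg[of u0] by simp
      ultimately show False using unit_axes(2)[OF M, of w0] Mp w1 M1 by auto
    qed
    hence "u0 \<noteq> 0" by auto
    show ?thesis
      by (rule key[of 0 1 "w - u / u0 * w0" "u / u0"])
        (use 2 u0 \<open>u0 \<noteq> 0\<close> l in \<open>auto simp: v_divide\<close>)
  qed
qed

text \<open>A value of \<open>M\<close> on a unit form that exceeds the infimum
  \<open>ndiam M\<close> is undercut by some other unit form, and then agrees with \<open>N\<close>.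
  So \<open>M\<close> differs from \<open>N\<close> only where it sits at its floor.\<close>

lemma eq_thicken:
  assumes N: "unit_seminorm N" and M: "unit_seminorm M" and le: "\<And>u w. N u w \<le> M u w"
  shows "M = thicken N (ndiam M)"
proof (intro ext)
  fix u w
  have ge: "thicken N (ndiam M) u w \<le> M u w"
    using le[of u w] ndiam_mult_le[OF M, of u w] by (simp add: thicken_def)
  have unit: "M u w \<le> max (N u w) (ndiam M)" if l: "max (v u) (v w) = 1" for u w
  proof (rule ccontr)
    assume no: "\<not> ?thesis"
    have "\<exists>u0 w0. max (v u0) (v w0) = 1 \<and> M u0 w0 < M u w"
    proof (rule ccontr)
      assume "\<not> ?thesis"
      hence "M u w \<le> ndiam M" by (intro ndiam_ge) (meson not_less)
      thus False using no by auto
    qed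
    then obtain u0 w0 where "max (v u0) (v w0) = 1" "M u0 w0 < M u w" by blast
    from unit_eq_above_smaller[OF N M le l this] no show False by auto
  qed
  have "M u w \<le> thicken N (ndiam M) u w"
  proof (cases "u = 0 \<and> w = 0")
    case False
    then obtain k where k: "k \<noteq> 0" "v k = max (v u) (v w)" "max (v (u / k)) (v (w / k)) = 1"
      using ex_unit_multiple[of u w] by auto
    have "M u w = v k * M (u / k) (w / k)" unfolding unit_scale[OF M, symmetric] using k by simp
    also have "\<dots> \<le> v k * max (N (u / k) (w / k)) (ndiam M)"
      using unit[OF k(3)] by (intro mult_left_mono) auto
    also have "\<dots> = max (N u w) (ndiam M * max (v u) (v w))"
      using k(1) by (simp add: max_mult_distrib_left[of "v k"] unit_scale[OF N, symmetric] k(2)[symmetric] mult.commute)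
    finally show ?thesis by (simp add: thicken_def)
  qed (simp add: unit_0[OF M] thicken_def le_max_iff_disj unit_nonneg[OF N])
  with ge show "M u w = thicken N (ndiam M) u w" by simp
qed

section \<open>The metric \<open>d\<close> on seminorms\<close>

definition ndist :: "('a \<Rightarrow> 'a \<Rightarrow> real) \<Rightarrow> ('a \<Rightarrow> 'a \<Rightarrow> real) \<Rightarrow> real" where
  "ndist N M = 2 * ndiam (\<lambda>u w. max (N u w) (M u w)) - ndiam N - ndiam M"

lemma ndist_commute: "ndist N M = ndist M N"
  by (simp add: ndist_def max.commute)

lemma ndist_comparable:
  assumes "\<And>u w. N u w \<le> M u w"
  shows "ndist N M = ndiam M - ndiam N"
proof -
  have "(\<lambda>u w. max (N u w) (M u w)) = M" using assms by (auto simp: fun_eq_iff max_absorb2)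
  thus ?thesis by (simp add: ndist_def)
qed

lemma ndist_nonneg:
  assumes N: "unit_seminorm N" and M: "unit_seminorm M"
  shows "0 \<le> ndist N M"
proof -
  have "ndiam N \<le> ndiam (\<lambda>u w. max (N u w) (M u w))" "ndiam M \<le> ndiam (\<lambda>u w. max (N u w) (M u w))"
    using N M by (auto intro!: ndiam_mono)
  thus ?thesis by (simp add: ndist_def)
qed

text \<open>The seminorms above a given one form a chain, so one of the two joins with the middle
  point dominates everything.\<close>

lemma ndist_triangle:
  assumes N: "unit_seminorm N" and P: "unit_seminorm P" and M: "unit_seminorm M"
  shows "ndist N M \<le> ndist N P + ndist P M"
proof -
  define A where "A = (\<lambda>u w. max (N u w) (P u w))"
  define B where "B = (\<lambda>u w. max (P u w) (M u w))"
  define J where "J = (\<lambda>u w. max (N u w) (M u w))"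
  have A: "unit_seminorm A" and B: "unit_seminorm B" and J: "unit_seminorm J"
    unfolding A_def B_def J_def using N P M by (auto intro: unit_seminorm_sup)
  have TA: "A = thicken P (ndiam A)" by (rule eq_thicken[OF P A]) (simp add: A_def)
  have TB: "B = thicken P (ndiam B)" by (rule eq_thicken[OF P B]) (simp add: B_def)
  have mono: "thicken P x u w \<le> thicken P y u w" if "x \<le> y" for x y u w
    unfolding thicken_def using that by (intro max.mono mult_right_mono) (auto simp: le_max_iff_disj)
  have "ndiam J \<le> max (ndiam A) (ndiam B)"
  proof (cases "ndiam A \<le> ndiam B")
    case True
    hence "A u w \<le> B u w" for u w using mono TA TB by metis
    hence "J u w \<le> B u w" for u w by (auto simp: A_def B_def J_def intro: order_trans)
    thus ?thesis using ndiam_mono[OF J, of B] by auto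
  next
    case False
    hence "B u w \<le> A u w" for u w using mono TA TB by (metis linear)
    hence "J u w \<le> A u w" for u w by (auto simp: A_def B_def J_def intro: order_trans)
    thus ?thesis using ndiam_mono[OF J, of A] by auto
  qed
  moreover have "ndiam P \<le> ndiam A" "ndiam P \<le> ndiam B"
    by (auto simp: A_def B_def intro!: ndiam_mono P)
  ultimately show ?thesis unfolding ndist_def A_def[symmetric] B_def[symmetric] J_def[symmetric]
    by auto
qed

section \<open>The diameter through pairs of forms\<close>

text \<open>A linear change of coordinates does not preserve the unit forms used by
  \<open>ndiam\<close>, but it multiplies all determinants by one constant. This second description
  of the diameter is the one that transforms well.\<close>

definition nvol :: "('a \<Rightarrow> 'a \<Rightarrow> real) \<Rightarrow> real" where
  "nvol N = Inf {N u w * N u' w' | u w u' w'. v (u * w' - u' * w) = 1}"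

lemma nvol_le:
  assumes N: "unit_seminorm N"
  shows "nvol N * v (u * w' - u' * w) \<le> N u w * N u' w'"
proof (cases "u * w' - u' * w = 0")
  case False
  let ?d = "u * w' - u' * w"
  have "(u / ?d) * w' - u' * (w / ?d) = ?d / ?d" by (simp only: diff_divide_distrib times_divide_eq_left times_divide_eq_right)
  hence "v ((u / ?d) * w' - u' * (w / ?d)) = 1" using False by simp
  hence "nvol N \<le> N (u / ?d) (w / ?d) * N u' w'"
    unfolding nvol_def using unit_nonneg[OF N] by (intro cInf_lower bdd_belowI[of _ 0]) (blast, auto)
  hence "v ?d * nvol N \<le> v ?d * (N (u / ?d) (w / ?d) * N u' w')" by (intro mult_left_mono) auto
  also have "\<dots> = N (?d * (u / ?d)) (?d * (w / ?d)) * N u' w'" by (simp only: unit_scale[OF N] mult.assoc)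
  also have "\<dots> = N u w * N u' w'" using False by simp
  finally show ?thesis by (simp add: mult.commute)
qed (simp add: unit_nonneg[OF N])

lemma nvol_ge: "(\<And>u w u' w'. B * v (u * w' - u' * w) \<le> N u w * N u' w') \<Longrightarrow> B \<le> nvol N"
  unfolding nvol_def
proof (rule cInf_greatest)
  have "v (1 * 1 - 0 * 0) = 1" by simp
  thus "{N u w * N u' w' | u w u' w'. v (u * w' - u' * w) = 1} \<noteq> {}" by blast
  fix x
  assume *: "\<And>u w u' w'. B * v (u * w' - u' * w) \<le> N u w * N u' w'"
    and "x \<in> {N u w * N u' w' | u w u' w'. v (u * w' - u' * w) = 1}"
  then obtain u w u' w' where "x = N u w * N u' w'" "v (u * w' - u' * w) = 1" by blast
  thus "B \<le> x" using *[of u w' u' w] by simp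
qed

text \<open>A unit form has a coordinate form as partner with unit determinant, and coordinate forms
  have value at most 1. Conversely \<open>det_le_comb\<close> bounds a determinant by values times
  coefficient norms, and \<open>ndiam_mult_le\<close> trades each coefficient norm for a
  value.\<close>

lemma nvol_eq_ndiam:
  assumes N: "unit_seminorm N"
  shows "nvol N = ndiam N"
proof (rule antisym)
  show "nvol N \<le> ndiam N"
  proof (rule ndiam_ge)
    fix u w assume l: "max (v u) (v w) = 1"
    have N1: "N 1 0 \<le> 1" "N 0 1 \<le> 1" using unit_max[OF N] by auto
    from l consider "v u = 1" | "v w = 1" by (auto simp: max_def split: if_splits)
    thus "nvol N \<le> N u w"
    proof cases
      case 1
      have "nvol N \<le> N u w * N 0 1" using nvol_le[OF N, of u 1 0 w] 1 by simp
      also have "\<dots> \<le> N u w * 1" using N1 unit_nonneg[OF N] by (intro mult_left_mono) auto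
      finally show ?thesis by simp
    next
      case 2
      have "nvol N \<le> N u w * N 1 0" using nvol_le[OF N, of u 0 1 w] 2 by simp
      also have "\<dots> \<le> N u w * 1" using N1 unit_nonneg[OF N] by (intro mult_left_mono) auto
      finally show ?thesis by simp
    qed
  qed
  show "ndiam N \<le> nvol N"
  proof (rule nvol_ge)
    fix u w u' w'
    have "ndiam N * v (u * w' - u' * w)
        \<le> ndiam N * max (max (v u') (v w') * N u w) (max (v u) (v w) * N u' w')"
      by (intro mult_left_mono det_le_comb N ndiam_nonneg)
    also have "\<dots> = max ((ndiam N * max (v u') (v w')) * N u w) ((ndiam N * max (v u) (v w)) * N u' w')"
      using ndiam_nonneg[OF N] by (subst max_mult_distrib_left) (simp add: mult.assoc)
    also have "\<dots> \<le> max (N u' w' * N u w) (N u w * N u' w')"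
      by (intro max.mono mult_right_mono ndiam_mult_le N unit_nonneg)
    finally show "ndiam N * v (u * w' - u' * w) \<le> N u w * N u' w'" by (simp add: mult.commute)
  qed
qed

text \<open>The pairs \<open>X - aY\<close>, \<open>Y\<close> are the only ones that
  \<open>diamG\<close> sees. For two forms \<open>X - pY\<close> and \<open>X - rY\<close>,
  replacing the one of larger value by their difference, a multiple of \<open>Y\<close>, keeps the
  determinant up to sign and does not increase the product.\<close>

lemma nvol_ge_affine:
  assumes N: "unit_seminorm N" and I: "\<And>a. I \<le> N 1 (- a) * N 0 1"
  shows "I \<le> nvol N"
proof (rule nvol_ge)
  have lin: "N u w = v u * N 1 (- (- w / u))" if "u \<noteq> 0" for u w :: 'a
    unfolding unit_scale[OF N, symmetric] using that by simp
  have axis: "I * v (u' * w) \<le> N 0 w * N u' w'" for w u' w'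
  proof (cases "u' = 0")
    case False
    have "I * v (u' * w) \<le> (N 1 (- (- w' / u')) * N 0 1) * v (u' * w)"
      by (intro mult_right_mono I) auto
    also have "\<dots> = N 0 w * N u' w'"
      unfolding lin[OF False, of w'] unit_axes(2)[OF N, of w] by (simp add: v_mult mult_ac)
    finally show ?thesis .
  qed (simp add: unit_nonneg[OF N])
  fix u w u' w' :: 'a
  consider "u = 0" | "u' = 0" | "u \<noteq> 0" "u' \<noteq> 0" by blast
  thus "I * v (u * w' - u' * w) \<le> N u w * N u' w'"
  proof cases
    case 1
    thus ?thesis using axis[of u' w w'] by simp
  next
    case 2
    thus ?thesis using axis[of u w' w] by (simp add: mult.commute)
  next
    case 3
    define p where "p = - w / u"
    define r where "r = - w' / u'"
    have d: "u * w' - u' * w = u * u' * (p - r)" using 3 by (simp add: p_def r_def field_simps)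
    have "N 0 (p - r) \<le> max (N 1 (- p)) (N 1 (- r))"
      using unit_diff[OF N, of 1 1 "- r" "- p"] by (simp add: max.commute)
    hence mx: "v (p - r) * N 0 1 \<le> max (N 1 (- p)) (N 1 (- r))"
      by (simp only: unit_axes(2)[OF N, of "p - r"])
    have "I * v (p - r) \<le> N 1 (- p) * N 1 (- r)"
    proof (cases "N 1 (- p) \<le> N 1 (- r)")
      case True
      have "I * v (p - r) \<le> (N 1 (- p) * N 0 1) * v (p - r)" by (intro mult_right_mono I) auto
      also have "\<dots> = N 1 (- p) * (v (p - r) * N 0 1)" by simp
      also have "\<dots> \<le> N 1 (- p) * N 1 (- r)" using True mx unit_nonneg[OF N] by (intro mult_left_mono) auto
      finally show ?thesis .
    next
      case False
      have "I * v (p - r) \<le> (N 1 (- r) * N 0 1) * v (p - r)" by (intro mult_right_mono I) auto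
      also have "\<dots> = N 1 (- r) * (v (p - r) * N 0 1)" by simp
      also have "\<dots> \<le> N 1 (- r) * N 1 (- p)" using False mx unit_nonneg[OF N] by (intro mult_left_mono) auto
      finally show ?thesis by (simp add: mult.commute)
    qed
    hence "(v u * v u') * (I * v (p - r)) \<le> (v u * v u') * (N 1 (- p) * N 1 (- r))"
      by (intro mult_left_mono) auto
    thus ?thesis unfolding d lin[OF 3(1), of w, folded p_def] lin[OF 3(2), of w', folded r_def]
      by (simp add: v_mult mult_ac)
  qed
qed

subsection \<open>Berkovich points as normalized seminorms\<close>

text \<open>Restricting a point to linear forms \<open>uX + wY\<close> and rescaling loses no information, and it
  makes the Gauss point, rather than \<open>\<infinity>\<close>, the root of the tree.\<close>

fun linorm :: "'a berk \<Rightarrow> 'a \<Rightarrow> 'a \<Rightarrow> real" where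
  "linorm (BFin s) u w = s [:w, u:] / max 1 (s [:0, 1:])"
| "linorm BInf u w = v u"

lemma BFin_mem [simp]: "BFin s \<in> P1Berk v \<longleftrightarrow> berk_seminorm v s"
  and BInf_mem [simp]: "BInf \<in> P1Berk v"
  by (auto simp: P1Berk_def)

lemma seminorm_linear:
  assumes s: "berk_seminorm v s" and "u \<noteq> 0"
  shows "s [:w, u:] = v u * s [:- (- w / u), 1:]"
  using seminorm_smult[OF s, of u "[:w / u, 1:]"] assms by simp

lemma unit_linorm:
  assumes "x \<in> P1Berk v"
  shows "unit_seminorm (linorm x)"
proof (cases x)
  case (BFin s)
  hence s: "berk_seminorm v s" using assms by simp
  have m: "0 < max 1 (s [:0, 1:])" by simp
  show ?thesis unfolding BFin unit_seminorm_def linorm.simps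
  proof (intro conjI allI)
    fix u w u' w' k
    show "0 \<le> s [:w, u:] / max 1 (s [:0, 1:])" using m seminorm_nonneg[OF s] by auto
    show "s [:k * w, k * u:] / max 1 (s [:0, 1:]) = v k * (s [:w, u:] / max 1 (s [:0, 1:]))"
      using seminorm_smult[OF s, of k "[:w, u:]"] by simp
    show "s [:w + w', u + u':] / max 1 (s [:0, 1:])
        \<le> max (s [:w, u:] / max 1 (s [:0, 1:])) (s [:w', u':] / max 1 (s [:0, 1:]))"
      using seminorm_ultra[OF s, of "[:w, u:]" "[:w', u':]"] by (intro divide_le_max m) simp
    show "max (s [:0, 1:] / max 1 (s [:0, 1:])) (s [:1, 0:] / max 1 (s [:0, 1:])) = 1"
      by (cases "s [:0, 1:] \<le> 1") (auto simp: seminorm_const[OF s] max_def field_simps)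
  qed
next
  case BInf
  show ?thesis unfolding BInf unit_seminorm_def linorm.simps
    by (auto simp: v_mult v_add)
qed

lemma linorm_01: "berk_seminorm v s \<Longrightarrow> linorm (BFin s) 0 1 = 1 / max 1 (s [:0, 1:])"
  by (simp add: seminorm_const)

text \<open>The value at \<open>Y\<close> is 0 only at infinity and otherwise reveals the rescaling
  factor; undoing it recovers all values on \<open>T - a\<close>, which determine the point.\<close>

lemma linorm_inject:
  assumes x: "x \<in> P1Berk v" and y: "y \<in> P1Berk v" and eq: "linorm x = linorm y"
  shows "x = y"
proof -
  have no: False if "berk_seminorm v s" "linorm (BFin s) = linorm BInf" for s
  proof -
    have "linorm (BFin s) 0 1 = 0" using that(2) by simp
    moreover have "0 < max 1 (s [:0, 1:])" by simp
    ultimately show False unfolding linorm_01[OF that(1)] by auto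
  qed
  show ?thesis
  proof (cases x)
    case xs: (BFin s)
    hence s: "berk_seminorm v s" using x by simp
    show ?thesis
    proof (cases y)
      case yt: (BFin t)
      hence t: "berk_seminorm v t" using y by simp
      have pos: "0 < max 1 (s [:0, 1:])" by simp
      have "linorm (BFin s) 0 1 = linorm (BFin t) 0 1" using eq xs yt by simp
      hence m: "max 1 (s [:0, 1:]) = max 1 (t [:0, 1:])"
        unfolding linorm_01[OF s] linorm_01[OF t] by (simp add: field_simps)
      have "s [:-a, 1:] = t [:-a, 1:]" for a
      proof -
        have "linorm (BFin s) 1 (-a) = linorm (BFin t) 1 (-a)" using eq xs yt by simp
        thus ?thesis using pos unfolding linorm.simps m by simp
      qed
      thus ?thesis using seminorm_eqI[OF s t] xs yt by simp
    next
      case BInf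
      thus ?thesis using no[OF s] eq xs by simp
    qed
  next
    case BInf
    show ?thesis
    proof (cases y)
      case (BFin t)
      thus ?thesis using no[of t] eq BInf y by simp
    qed (simp add: BInf)
  qed
qed

text \<open>Dehomogenizing by the value at \<open>Y\<close> yields a radius function, and its
  extension is the required point. This is where points that are not discs are constructed.\<close>

lemma linorm_surj:
  assumes N: "unit_seminorm N"
  shows "\<exists>x\<in>P1Berk v. linorm x = N"
proof (cases "N 0 1 = 0")
  case True
  hence N1: "N 1 0 = 1" using unit_max[OF N] unit_nonneg[OF N, of 1 0] by (auto simp: max_def split: if_splits)
  have "N u w = v u" for u w
    using unit_add[OF N, of u 0 0 w] unit_diff[OF N, of u 0 w w]
      unit_axes(1)[OF N, of u] unit_axes(2)[OF N, of w] True N1 unit_nonneg[OF N, of u w] by auto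
  hence "linorm BInf = N" by (simp add: fun_eq_iff)
  thus ?thesis by (intro bexI[of _ BInf]) auto
next
  case False
  hence pos: "0 < N 0 1" using unit_nonneg[OF N, of 0 1] by simp
  define \<rho> where "\<rho> a = N 1 (- a) / N 0 1" for a
  have \<rho>: "radius_fun \<rho>" unfolding radius_fun_def
  proof (intro conjI allI)
    fix a b
    show "0 \<le> \<rho> a" using pos unit_nonneg[OF N] by (simp add: \<rho>_def)
    have vb: "v (a - b) = N 0 (a - b) / N 0 1"
      using pos unit_axes(2)[OF N, of "a - b"] by simp
    have "N 1 (- a) \<le> max (N 1 (- b)) (N 0 (a - b))"
      using unit_diff[OF N, of 1 0 "- b" "a - b"] by simp
    thus "\<rho> a \<le> max (\<rho> b) (v (a - b))" unfolding vb \<rho>_def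
      by (rule divide_le_max[OF pos])
    have "N 0 (a - b) \<le> max (N 1 (- a)) (N 1 (- b))"
      using unit_diff[OF N, of 1 1 "- b" "- a"] by (simp add: max.commute)
    thus "v (a - b) \<le> max (\<rho> a) (\<rho> b)" unfolding vb \<rho>_def
      by (rule divide_le_max[OF pos])
  qed
  define s where "s = radius_ext \<rho>"
  have s: "berk_seminorm v s" unfolding s_def by (rule radius_ext_seminorm[OF \<rho>])
  have val: "s [:w, u:] = N u w / N 0 1" for u w
  proof (cases "u = 0")
    case True
    thus ?thesis using pos unit_axes(2)[OF N, of w] by (simp add: seminorm_const[OF s])
  next
    case False
    have "s [:w, u:] = v u * \<rho> (- w / u)"
      unfolding seminorm_linear[OF s False] unfolding s_def radius_ext_linear[OF \<rho>] ..
    also have "v u * \<rho> (- w / u) = v u * N 1 (w / u) / N 0 1" by (simp add: \<rho>_def)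
    also have "v u * N 1 (w / u) = N u w" unfolding unit_scale[OF N, symmetric] using False by simp
    finally show ?thesis .
  qed
  have "max 1 (s [:0, 1:]) = max (N 0 1) (N 1 0) / N 0 1"
    using pos by (simp add: val max_divide_distrib_right)
  hence "max 1 (s [:0, 1:]) = 1 / N 0 1" using unit_max[OF N] by (simp add: max.commute)
  hence "linorm (BFin s) = N" using pos by (simp add: fun_eq_iff val)
  thus ?thesis using s by (intro bexI[of _ "BFin s"]) auto
qed

text \<open>\<open>s (T - a) / (max 1 (s T))\<^sup>2\<close> is the product of the normalized values
  at \<open>X - aY\<close> and \<open>Y\<close>, a pair of determinant 1; the square comes from
  rescaling both forms.\<close>

lemma diamG_eq:
  assumes "x \<in> P1Berk v"
  shows "diamG v x = ndiam (linorm x)"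
proof (cases x)
  case (BFin s)
  hence s: "berk_seminorm v s" using assms by simp
  note N = unit_linorm[OF assms]
  define m where "m = max 1 (s [:0, 1:])"
  have m: "0 < m" by (simp add: m_def)
  have prod: "linorm x 1 (- a) * linorm x 0 1 = s [:-a, 1:] / m\<^sup>2" for a
    unfolding BFin linorm.simps m_def[symmetric] by (simp add: seminorm_const[OF s] power2_eq_square)
  have "(INF a. s [:-a, 1:]) \<le> s [:-a, 1:]" for a
    by (rule cINF_lower) (auto intro!: bdd_belowI[of _ 0] seminorm_nonneg[OF s])
  hence "(INF a. s [:-a, 1:]) / m\<^sup>2 \<le> linorm x 1 (- a) * linorm x 0 1" for a
    unfolding prod using m by (simp add: divide_right_mono)
  hence "(INF a. s [:-a, 1:]) / m\<^sup>2 \<le> nvol (linorm x)" by (rule nvol_ge_affine[OF N])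
  moreover have "nvol (linorm x) * m\<^sup>2 \<le> (INF a. s [:-a, 1:])"
  proof (rule cINF_greatest)
    fix a
    have "nvol (linorm x) \<le> s [:-a, 1:] / m\<^sup>2"
      using nvol_le[OF N, of 1 1 0 "- a"] by (simp add: prod)
    thus "nvol (linorm x) * m\<^sup>2 \<le> s [:-a, 1:]" using m by (simp add: field_simps)
  qed simp
  hence "nvol (linorm x) \<le> (INF a. s [:-a, 1:]) / m\<^sup>2" using m by (simp add: field_simps)
  ultimately show ?thesis unfolding nvol_eq_ndiam[OF N, symmetric] by (simp add: BFin m_def)
next
  case BInf
  note N = unit_linorm[OF assms]
  have "ndiam (linorm x) \<le> linorm x 0 1" by (rule ndiam_le[OF N]) simp
  thus ?thesis using ndiam_nonneg[OF N] by (simp add: BInf)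
qed

lemma zetaG_eq: "zetaG v = BFin (disc 0 1)"
  by (simp add: zetaG_def disc_def gauss_def pcompose_idR fun_eq_iff)

lemma zetaG_mem: "zetaG v \<in> P1Berk v"
  by (simp add: zetaG_eq disc_seminorm)

lemma linorm_zetaG: "linorm (zetaG v) = (\<lambda>u w. max (v u) (v w))"
proof (intro ext)
  fix u w
  have "disc 0 1 [:w, u:] = max (v u) (v w)"
  proof (cases "u = 0")
    case True
    thus ?thesis by (simp add: seminorm_const[OF disc_seminorm])
  next
    case False
    have "disc 0 1 [:w, u:] = v u * max (v (w / u)) 1"
      using seminorm_linear[OF disc_seminorm False, of 1 0 w] disc_linear[of 0 1 "- w / u"] by simp
    also have "\<dots> = max (v w) (v u)" using False by (simp add: v_divide max_mult_distrib_left)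
    finally show ?thesis by (simp add: max.commute)
  qed
  moreover have "disc 0 1 [:0, 1:] = 1" using disc_linear[of 0 1 0] by simp
  ultimately show "linorm (zetaG v) u w = max (v u) (v w)" by (simp add: zetaG_eq)
qed

section \<open>Joins and segments of the tree\<close>

lemma berk_le_radius:
  assumes "berk_seminorm v s" "berk_seminorm v t"
  shows "berk_le (BFin s) (BFin t) \<longleftrightarrow> (\<forall>a. s [:-a, 1:] \<le> t [:-a, 1:])"
  using seminorm_le_of_linear_factors[OF assms] by auto

lemma radius_fun_sup:
  assumes "radius_fun \<rho>" "radius_fun \<sigma>"
  shows "radius_fun (\<lambda>a. max (\<rho> a) (\<sigma> a))"
  unfolding radius_fun_def
proof (intro conjI allI)
  fix a b
  have "0 \<le> \<rho> a" "\<rho> a \<le> max (\<rho> b) (v (a - b))" "v (a - b) \<le> max (\<rho> a) (\<rho> b)"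
    "\<sigma> a \<le> max (\<sigma> b) (v (a - b))"
    using assms by (auto simp: radius_fun_def)
  thus "0 \<le> max (\<rho> a) (\<sigma> a)" "max (\<rho> a) (\<sigma> a) \<le> max (max (\<rho> b) (\<sigma> b)) (v (a - b))"
    "v (a - b) \<le> max (max (\<rho> a) (\<sigma> a)) (max (\<rho> b) (\<sigma> b))" by linarith+
qed

lemma berk_le_antisym: "berk_le x y \<Longrightarrow> berk_le y x \<Longrightarrow> x = y"
  by (cases x; cases y) (auto simp: fun_eq_iff intro: antisym)

lemma berk_join_BInf: "berk_join v BInf y = BInf"
  unfolding berk_join_def
proof (rule the_equality)
  fix z
  assume "z \<in> P1Berk v \<and> berk_le BInf z \<and> berk_le y z
      \<and> (\<forall>w\<in>P1Berk v. berk_le BInf w \<and> berk_le y w \<longrightarrow> berk_le z w)"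
  thus "z = BInf" by (cases z) auto
next
  show "BInf \<in> P1Berk v \<and> berk_le BInf BInf \<and> berk_le y BInf
      \<and> (\<forall>w\<in>P1Berk v. berk_le BInf w \<and> berk_le y w \<longrightarrow> berk_le BInf w)" by auto
qed

text \<open>The order is decided on the factors \<open>T - a\<close>, and the maximum of two radius
  functions is again one, so its extension is the least upper bound.\<close>

lemma berk_join_BFin:
  assumes s: "berk_seminorm v s" and t: "berk_seminorm v t"
  defines "j \<equiv> radius_ext (\<lambda>a. max (s [:-a, 1:]) (t [:-a, 1:]))"
  shows "berk_join v (BFin s) (BFin t) = BFin j" "berk_seminorm v j"
    "j [:-a, 1:] = max (s [:-a, 1:]) (t [:-a, 1:])"
proof -
  have r: "radius_fun (\<lambda>a. max (s [:-a, 1:]) (t [:-a, 1:]))"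
    by (intro radius_fun_sup seminorm_radius_fun s t)
  show j: "berk_seminorm v j" unfolding j_def by (rule radius_ext_seminorm[OF r])
  show jl: "j [:-a, 1:] = max (s [:-a, 1:]) (t [:-a, 1:])" for a
    unfolding j_def by (rule radius_ext_linear[OF r])
  have least: "berk_le (BFin j) w"
    if "w \<in> P1Berk v" "berk_le (BFin s) w" "berk_le (BFin t) w" for w
  proof (cases w)
    case (BFin q)
    hence q: "berk_seminorm v q" using that by simp
    show ?thesis using that unfolding BFin berk_le_radius[OF s q] berk_le_radius[OF t q]
        berk_le_radius[OF j q] jl by simp
  qed simp
  have up: "berk_le (BFin s) (BFin j)" "berk_le (BFin t) (BFin j)"
    unfolding berk_le_radius[OF s j] berk_le_radius[OF t j] jl by auto
  show "berk_join v (BFin s) (BFin t) = BFin j" unfolding berk_join_def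
  proof (rule the_equality)
    show "BFin j \<in> P1Berk v \<and> berk_le (BFin s) (BFin j) \<and> berk_le (BFin t) (BFin j)
      \<and> (\<forall>w\<in>P1Berk v. berk_le (BFin s) w \<and> berk_le (BFin t) w \<longrightarrow> berk_le (BFin j) w)"
      using up least j by auto
    fix z
    assume "z \<in> P1Berk v \<and> berk_le (BFin s) z \<and> berk_le (BFin t) z
      \<and> (\<forall>w\<in>P1Berk v. berk_le (BFin s) w \<and> berk_le (BFin t) w \<longrightarrow> berk_le z w)"
    thus "z = BFin j" using up least j by (intro berk_le_antisym) auto
  qed
qed

lemma radius_fun_0:
  assumes "radius_fun p"
  shows "p c \<le> max (p 0) (v c)" "p 0 \<le> max (p c) (v c)" "v c \<le> max (p c) (p 0)" "0 \<le> p c"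
proof -
  have 1: "p a \<le> max (p b) (v (a - b))" and 2: "v (a - b) \<le> max (p a) (p b)" and 3: "0 \<le> p a" for a b
    using assms by (auto simp: radius_fun_def)
  from 1[of c 0] 1[of 0 c] 2[of c 0] 3[of c]
  show "p c \<le> max (p 0) (v c)" "p 0 \<le> max (p c) (v c)" "v c \<le> max (p c) (p 0)" "0 \<le> p c" by auto
qed

text \<open>On the left, \<open>q\<close> lies on the path from \<open>p\<close> up to its join with
  the Gauss point (radii \<open>max 1 (v c)\<close>) or from that join down to the Gauss point. On
  the right is the pointwise order of the normalized seminorms, with denominators cleared. On the
  first leg the denominators agree; on the second, \<open>mq\<close> is \<open>q 0\<close>.\<close>

lemma seg_radius_iff:
  assumes p: "radius_fun p" and q: "radius_fun q"
  defines "mp \<equiv> max 1 (p 0)" and "mq \<equiv> max 1 (q 0)"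
  shows "((\<forall>c. p c \<le> q c) \<or> (\<forall>c. max 1 (v c) \<le> q c)) \<and> (\<forall>c. q c \<le> max (p c) (max 1 (v c)))
     \<longleftrightarrow> mq \<le> mp \<and> (\<forall>c. p c * mq \<le> q c * mp)" (is "?L \<longleftrightarrow> ?R")
proof -
  note p1 = radius_fun_0(1)[OF p] and p2 = radius_fun_0(2)[OF p]
  note q1 = radius_fun_0(1)[OF q] and q2 = radius_fun_0(2)[OF q] and q3 = radius_fun_0(3)[OF q]
    and q4 = radius_fun_0(4)[OF q]
  show ?thesis
  proof
    assume L: ?L
    hence qu: "q c \<le> max (p c) (max 1 (v c))" for c by blast
    have mqp: "mq \<le> mp" using qu[of 0] by (auto simp: mp_def mq_def)
    show ?R
    proof (intro conjI allI mqp)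
      fix c
      show "p c * mq \<le> q c * mp"
      proof (cases "\<forall>c. p c \<le> q c")
        case True
        hence "p 0 \<le> q 0" by blast
        hence "mq = mp" using mqp by (auto simp: mp_def mq_def)
        thus ?thesis using True by (auto intro!: mult_right_mono simp: mp_def le_max_iff_disj)
      next
        case False
        hence g: "1 \<le> q c" "v c \<le> q c" for c using L by auto
        have mq: "mq = q 0" using g(1)[of 0] by (simp add: mq_def)
        have qc: "mq \<le> q c" using q2[of c] g(2)[of c] mq by auto
        have "p c * mq \<le> max mp (v c) * mq"
          using p1[of c] g(1)[of 0] by (intro mult_right_mono) (auto simp: mp_def mq)
        also have "\<dots> \<le> q c * mp"
        proof (cases "v c \<le> mp")
          case True
          have "mp * mq \<le> mp * q c" using qc by (intro mult_left_mono) (auto simp: mp_def)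
          thus ?thesis using True by (simp add: mult.commute)
        next
          case False
          have "v c * mq \<le> q c * mp" using g(2)[of c] mqp q4 by (intro mult_mono) (auto simp: mq)
          thus ?thesis using False by simp
        qed
        finally show ?thesis .
      qed
    qed
  next
    assume R: ?R
    have "q c \<le> max (p c) (max 1 (v c))" for c
      using q1[of c] R p2[of c] by (auto simp: mp_def mq_def)
    \<comment> \<open>Equal denominators mean the leg below the join on the side of
      \<open>p\<close>; a smaller one for \<open>q\<close> means the leg towards the Gauss
      point.\<close>
    moreover have "(\<forall>c. p c \<le> q c) \<or> (\<forall>c. max 1 (v c) \<le> q c)"
    proof (cases "mq = mp")
      case True
      moreover have "0 < mp" by (simp add: mp_def)
      ultimately have "p c \<le> q c" for c using R by auto
      thus ?thesis by blast
    next
      case False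
      hence lt: "mq < mp" using R by simp
      hence mp: "mp = p 0" "1 < mp" by (auto simp: mp_def mq_def max_def split: if_splits)
      have "p 0 * mq \<le> q 0 * mp" using R by blast
      hence q0: "mq = q 0" using mp by (simp add: mp mq_def mult.commute)
      have q01: "1 \<le> q 0" using q0 by (simp add: mq_def)
      have "max 1 (v c) \<le> q c" for c
      proof -
        \<comment> \<open>Unless \<open>v c = q 0\<close>, the ultrametric inequality alone bounds
          \<open>q c\<close> from below. In the critical case the bound is imported from
          \<open>p\<close>, where \<open>v c < p 0\<close> forces
          \<open>p 0 \<le> p c\<close>.\<close>
        consider "v c < q 0" | "v c > q 0" | "v c = q 0" by linarith
        thus ?thesis
        proof cases
          case 3
          hence "p 0 \<le> p c" using p2[of c] lt mp q0 by auto
          hence "mp * mq \<le> p c * mq" using mp q0 q01 by (intro mult_right_mono) auto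
          also have "\<dots> \<le> q c * mp" using R by blast
          finally have "mq \<le> q c" using mp by (simp add: mult.commute)
          thus ?thesis using 3 q0 q01 by simp
        qed (use q2[of c] q3[of c] q01 in auto)
      qed
      thus ?thesis by blast
    qed
    ultimately show ?L by blast
  qed
qed

lemma linorm_le_iff:
  assumes s: "berk_seminorm v s" and t: "berk_seminorm v t"
  shows "(\<forall>u w. linorm (BFin s) u w \<le> linorm (BFin t) u w) \<longleftrightarrow>
    max 1 (t [:0, 1:]) \<le> max 1 (s [:0, 1:]) \<and>
    (\<forall>c. s [:-c, 1:] * max 1 (t [:0, 1:]) \<le> t [:-c, 1:] * max 1 (s [:0, 1:]))"
proof -
  define m where "m = max 1 (s [:0, 1:])"
  define n where "n = max 1 (t [:0, 1:])"
  have mn: "0 < m" "0 < n" by (auto simp: m_def n_def)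
  have le: "linorm (BFin s) u w \<le> linorm (BFin t) u w \<longleftrightarrow> s [:w, u:] * n \<le> t [:w, u:] * m" for u w
    using mn by (simp add: m_def[symmetric] n_def[symmetric] field_simps)
  show ?thesis unfolding le m_def[symmetric] n_def[symmetric]
  proof safe
    assume *: "\<forall>u w. s [:w, u:] * n \<le> t [:w, u:] * m"
    \<comment> \<open>The form \<open>Y\<close>, that is the constant polynomial 1, compares the
      denominators.\<close>
    show "n \<le> m" using *[rule_format, of 1 0] by (simp add: seminorm_const[OF s] seminorm_const[OF t])
    show "s [:- c, 1:] * n \<le> t [:- c, 1:] * m" for c using * by blast
  next
    fix u w
    assume nm: "n \<le> m" and *: "\<forall>c. s [:- c, 1:] * n \<le> t [:- c, 1:] * m"
    show "s [:w, u:] * n \<le> t [:w, u:] * m"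
    proof (cases "u = 0")
      case True
      thus ?thesis using nm by (simp add: seminorm_const[OF s] seminorm_const[OF t] mult_left_mono)
    next
      case False
      have "v u * (s [:- (- w / u), 1:] * n) \<le> v u * (t [:- (- w / u), 1:] * m)"
        by (intro mult_left_mono *[rule_format] v_nonneg)
      thus ?thesis unfolding seminorm_linear[OF s False] seminorm_linear[OF t False]
        by (simp only: mult.assoc)
    qed
  qed
qed

text \<open>This moves the root from infinity to the Gauss point. Finite points are handled by
  \<open>seg_radius_iff\<close>; infinity has no radius function and is treated separately, both as
  start and as candidate on the path.\<close>

lemma seg_zetaG:
  assumes x: "x \<in> P1Berk v"
  shows "seg v x (zetaG v) = {z \<in> P1Berk v. \<forall>u w. linorm x u w \<le> linorm z u w}"
proof -
  let ?g = "disc 0 1"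
  have g: "berk_seminorm v ?g" by (rule disc_seminorm) simp
  have gl: "?g [:-c, 1:] = max 1 (v c)" for c using disc_linear[of 0 1 c] by (simp add: max.commute)
  have iff: "(berk_le x z \<and> berk_le z (berk_join v x (zetaG v)) \<or>
       berk_le (zetaG v) z \<and> berk_le z (berk_join v x (zetaG v)))
       \<longleftrightarrow> (\<forall>u w. linorm x u w \<le> linorm z u w)" if z: "z \<in> P1Berk v" for z
  proof (cases x)
    case xs: (BFin s)
    hence s: "berk_seminorm v s" using x by simp
    obtain j where J: "berk_join v (BFin s) (BFin ?g) = BFin j" "berk_seminorm v j"
        "\<And>a. j [:-a, 1:] = max (s [:-a, 1:]) (?g [:-a, 1:])"
      using berk_join_BFin[OF s g] by blast
    show ?thesis
    proof (cases z)
      case zt: (BFin t)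
      hence t: "berk_seminorm v t" using z by simp
      show ?thesis
        using seg_radius_iff[OF seminorm_radius_fun[OF s] seminorm_radius_fun[OF t], unfolded minus_zero]
        unfolding xs zt zetaG_eq J(1) berk_le_radius[OF s t] berk_le_radius[OF t J(2)]
          berk_le_radius[OF g t] J(3) gl linorm_le_iff[OF s t] by blast
    next
      case BInf
      have "\<not> linorm (BFin s) 0 1 \<le> linorm BInf 0 1"
        unfolding linorm_01[OF s] by (simp add: not_le)
      hence "\<not> (\<forall>u w. linorm (BFin s) u w \<le> linorm BInf u w)" by blast
      thus ?thesis unfolding xs BInf zetaG_eq J(1) by (simp del: linorm.simps)
    qed
  next
    case xi: BInf
    show ?thesis
    proof (cases z)
      case zt: (BFin t)
      hence t: "berk_seminorm v t" using z by simp
      note rt = seminorm_radius_fun[OF t]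
      let ?m = "max 1 (t [:0, 1:])"
      have m: "0 < ?m" by simp
      have r: "t [:0, 1:] \<le> max (t [:-c, 1:]) (v c)" "v c \<le> max (t [:-c, 1:]) (t [:0, 1:])" for c
        using radius_fun_0(2,3)[OF rt, of c] by simp_all
      have "(\<forall>u w. v u \<le> linorm z u w) \<longleftrightarrow> (\<forall>c. ?m \<le> t [:-c, 1:])"
      proof safe
        fix c assume "\<forall>u w. v u \<le> linorm z u w"
        hence "v 1 \<le> linorm z 1 (-c)" by blast
        thus "?m \<le> t [:-c, 1:]" unfolding zt linorm.simps using m by (simp add: le_divide_eq)
      next
        fix u w assume *: "\<forall>c. ?m \<le> t [:-c, 1:]"
        show "v u \<le> linorm z u w"
        proof (cases "u = 0")
          case True
          thus ?thesis using unit_nonneg[OF unit_linorm[OF z]] by simp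
        next
          case False
          have "v u * ?m \<le> v u * t [:- (- w / u), 1:]" by (intro mult_left_mono *[rule_format] v_nonneg)
          thus ?thesis unfolding zt linorm.simps seminorm_linear[OF t False] using m
            by (simp only: le_divide_eq if_True)
        qed
      qed
      also have "\<dots> \<longleftrightarrow> (\<forall>c. max 1 (v c) \<le> t [:-c, 1:])"
      proof safe
        fix c assume *: "\<forall>c. ?m \<le> t [:-c, 1:]"
        show "max 1 (v c) \<le> t [:-c, 1:]" using *[rule_format, of c] r(2)[of c] by auto
      next
        fix c assume *: "\<forall>c. max 1 (v c) \<le> t [:-c, 1:]"
        show "?m \<le> t [:-c, 1:]" using *[rule_format, of c] r(1)[of c] by auto
      qed
      finally show ?thesis unfolding xi berk_join_BInf zetaG_eq linorm.simps
        using zt berk_le_radius[OF g t] gl by auto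
    qed (simp add: xi berk_join_BInf)
  qed
  thus ?thesis unfolding seg_def by blast
qed

text \<open>Lying above two seminorms means lying above their maximum, so two paths to the Gauss
  point meet in the path of the maximum. Uniqueness holds because a point lies on its own
  path.\<close>

lemma veeG:
  assumes x: "x \<in> P1Berk v" and y: "y \<in> P1Berk v"
  shows "veeG v x y \<in> P1Berk v" "linorm (veeG v x y) = (\<lambda>u w. max (linorm x u w) (linorm y u w))"
proof -
  obtain z where z: "z \<in> P1Berk v" "linorm z = (\<lambda>u w. max (linorm x u w) (linorm y u w))"
    using linorm_surj[OF unit_seminorm_sup[OF unit_linorm[OF x] unit_linorm[OF y]]] by blast
  have sg: "seg v z (zetaG v) = seg v x (zetaG v) \<inter> seg v y (zetaG v)"
    unfolding seg_zetaG[OF x] seg_zetaG[OF y] seg_zetaG[OF z(1)] z(2) by auto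
  have "veeG v x y = z" unfolding veeG_def
  proof (rule the_equality)
    fix w assume w: "w \<in> P1Berk v \<and> seg v w (zetaG v) = seg v x (zetaG v) \<inter> seg v y (zetaG v)"
    hence eq: "seg v w (zetaG v) = seg v z (zetaG v)" using sg by simp
    have "w \<in> seg v w (zetaG v)" "z \<in> seg v z (zetaG v)"
      using seg_zetaG[of w] seg_zetaG[of z] w z by auto
    hence "w \<in> seg v z (zetaG v)" "z \<in> seg v w (zetaG v)" using eq by auto
    hence "linorm w u t \<le> linorm z u t" "linorm z u t \<le> linorm w u t" for u t
      unfolding seg_zetaG[OF conjunct1[OF w]] seg_zetaG[OF z(1)] by simp_all
    hence "linorm w = linorm z" by (intro ext antisym)
    thus "w = z" using linorm_inject w z by blast
  qed (use z sg in blast)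
  thus "veeG v x y \<in> P1Berk v" "linorm (veeG v x y) = (\<lambda>u w. max (linorm x u w) (linorm y u w))"
    using z by auto
qed

lemma berk_d_eq:
  assumes "x \<in> P1Berk v" "y \<in> P1Berk v"
  shows "berk_d v x y = ndist (linorm x) (linorm y)"
  using assms by (simp add: berk_d_def ndist_def diamG_eq veeG)

subsection \<open>Projective coordinates on \<open>P\<^sup>1(K)\<close>\<close>

definition proj :: "'a \<Rightarrow> 'a \<Rightarrow> 'a option" where
  "proj p r = (if r = 0 then None else Some (p / r))"

lemma ex_proj: "\<exists>p r. x = proj p r \<and> 0 < max (v p) (v r)"
proof (cases x)
  case None
  thus ?thesis by (intro exI[of _ 1] exI[of _ 0]) (simp add: proj_def)
next
  case (Some z)
  thus ?thesis by (intro exI[of _ z] exI[of _ 1]) (simp add: proj_def less_max_iff_disj)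
qed

lemma max_1_divide: "r \<noteq> 0 \<Longrightarrow> max 1 (v (p / r)) = max (v p) (v r) / v r"
  using v_pos[of r] by (auto simp: v_divide max_def field_simps)

lemma chordal_proj:
  assumes x: "0 < max (v p) (v r)" and y: "0 < max (v p') (v r')"
  shows "chordal v (proj p r) (proj p' r') = v (p * r' - p' * r) / (max (v p) (v r) * max (v p') (v r'))"
proof -
  consider "r = 0" "r' = 0" | "r = 0" "r' \<noteq> 0" | "r \<noteq> 0" "r' = 0" | "r \<noteq> 0" "r' \<noteq> 0" by blast
  thus ?thesis
  proof cases
    case 4
    have "p / r - p' / r' = (p * r' - p' * r) / (r * r')" using 4 by (simp add: field_simps)
    hence "v (p / r - p' / r') = v (p * r' - p' * r) / (v r * v r')" by (simp add: v_divide v_mult)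
    thus ?thesis using 4 v_pos[of r] v_pos[of r'] by (simp add: proj_def max_1_divide)
  qed (use x y in \<open>auto simp: proj_def max_1_divide v_mult\<close>)
qed

lemma linorm_typeI_proj:
  assumes "0 < max (v p) (v r)"
  shows "linorm (typeI v (proj p r)) u w = v (u * p + w * r) / max (v p) (v r)"
proof (cases "r = 0")
  case True
  thus ?thesis using assms by (auto simp: proj_def v_mult)
next
  case False
  have "w + p / r * u = (u * p + w * r) / r" using False by (simp add: field_simps)
  hence "linorm (typeI v (proj p r)) u w = v ((u * p + w * r) / r) / max 1 (v (p / r))"
    using False by (simp add: proj_def)
  thus ?thesis unfolding max_1_divide[OF False] using False by (simp add: v_divide)
qed

lemma typeI_mem: "typeI v x \<in> P1Berk v"
proof (cases x)
  case (Some z)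
  have "v (poly f z + poly g z) \<le> v (poly f z) + v (poly g z)" for f g
    using v_add[of "poly f z" "poly g z"] v_nonneg[of "poly f z"] v_nonneg[of "poly g z"] by linarith
  thus ?thesis unfolding Some by (simp add: berk_seminorm_def v_mult)
qed simp

text \<open>The form \<open>rX - pY\<close> vanishes at the point \<open>(p, r)\<close>, so both
  diameters are 0 and only the join counts. Its diameter is attained by a multiple of the same form;
  the lower bound is Cramer's rule for the two evaluations. The factor 2 cancels in Lipschitz
  quotients.\<close>

lemma berk_d_typeI: "berk_d v (typeI v x) (typeI v y) = 2 * chordal v x y"
proof -
  have zero: "ndiam (linorm (typeI v x)) = 0" for x
  proof -
    obtain p r where x: "x = proj p r" and pos: "0 < max (v p) (v r)" using ex_proj by blast
    note N = unit_linorm[OF typeI_mem[of x]]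
    have "ndiam (linorm (typeI v x)) * max (v r) (v (- p)) \<le> linorm (typeI v x) r (- p)"
      by (rule ndiam_mult_le[OF N])
    also have "\<dots> = 0" unfolding x linorm_typeI_proj[OF pos] by (simp add: mult.commute)
    finally have "ndiam (linorm (typeI v x)) \<le> 0"
      using pos by (auto simp: mult_le_0_iff max.commute)
    thus ?thesis using ndiam_nonneg[OF N] by simp
  qed
  obtain p r where x: "x = proj p r" and px: "0 < max (v p) (v r)" using ex_proj by blast
  obtain p' r' where y: "y = proj p' r'" and py: "0 < max (v p') (v r')" using ex_proj by blast
  define X where "X = max (v p) (v r)"
  define Y where "Y = max (v p') (v r')"
  have XY: "0 < X" "0 < Y" using px py by (simp_all add: X_def Y_def)
  define \<delta> where "\<delta> = p * r' - p' * r"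
  let ?M = "\<lambda>u w. max (linorm (typeI v x) u w) (linorm (typeI v y) u w)"
  have Mdef: "?M u w = max (v (u * p + w * r) / X) (v (u * p' + w * r') / Y)" for u w
    unfolding x y linorm_typeI_proj[OF px] linorm_typeI_proj[OF py] X_def Y_def ..
  have M: "unit_seminorm ?M" by (intro unit_seminorm_sup unit_linorm typeI_mem)
  have "v \<delta> / (X * Y) \<le> ndiam ?M"
  proof (rule ndiam_ge)
    fix u w assume l: "max (v u) (v w) = 1"
    have lX: "v (u * p + w * r) \<le> ?M u w * X" and lY: "v (u * p' + w * r') \<le> ?M u w * Y"
      using XY unfolding Mdef by (simp_all add: pos_divide_le_eq[symmetric])
    have M0: "0 \<le> ?M u w" by (rule unit_nonneg[OF M])
    have bnd: "v (u * p + w * r) * v z' \<le> ?M u w * (X * Y)" "v (u * p' + w * r') * v z \<le> ?M u w * (X * Y)"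
      if "v z' \<le> Y" "v z \<le> X" for z z'
    proof -
      have "v (u * p + w * r) * v z' \<le> (?M u w * X) * Y"
        using lX that M0 XY by (intro mult_mono) auto
      thus "v (u * p + w * r) * v z' \<le> ?M u w * (X * Y)" by (simp only: mult.assoc)
      have "v (u * p' + w * r') * v z \<le> (?M u w * Y) * X"
        using lY that M0 XY by (intro mult_mono) auto
      thus "v (u * p' + w * r') * v z \<le> ?M u w * (X * Y)" by (simp only: mult.assoc mult.commute[of X])
    qed
    have "u * \<delta> = (u * p + w * r) * r' - (u * p' + w * r') * r"
      "w * \<delta> = (u * p' + w * r') * p - (u * p + w * r) * p'" by (simp_all add: \<delta>_def algebra_simps)
    hence "v u * v \<delta> \<le> max (v (u * p + w * r) * v r') (v (u * p' + w * r') * v r)"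
      "v w * v \<delta> \<le> max (v (u * p' + w * r') * v p) (v (u * p + w * r) * v p')"
      using v_diff by (metis v_mult)+
    moreover have "v r' \<le> Y" "v p' \<le> Y" "v r \<le> X" "v p \<le> X" by (auto simp: X_def Y_def)
    ultimately have "v u * v \<delta> \<le> ?M u w * (X * Y)" "v w * v \<delta> \<le> ?M u w * (X * Y)"
      using bnd by (meson max.bounded_iff order_trans)+
    hence "v \<delta> \<le> ?M u w * (X * Y)" using l by (auto simp: max_def split: if_splits)
    thus "v \<delta> / (X * Y) \<le> ?M u w" using XY by (simp only: pos_divide_le_eq mult_pos_pos)
  qed
  moreover have "ndiam ?M \<le> v \<delta> / (X * Y)"
  proof -
    have "ndiam ?M * max (v r) (v (- p)) \<le> ?M r (- p)" by (rule ndiam_mult_le[OF M])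
    also have "\<dots> = v \<delta> / Y" unfolding Mdef using XY v_minus_commute[of "r * p'" "p * r'"]
      by (simp add: \<delta>_def mult.commute)
    finally show ?thesis using XY by (simp add: X_def[symmetric] max.commute field_simps)
  qed
  ultimately have "ndiam ?M = v \<delta> / (X * Y)" by simp
  thus ?thesis unfolding berk_d_eq[OF typeI_mem typeI_mem] ndist_def zero
    unfolding x y chordal_proj[OF px py] X_def Y_def \<delta>_def by simp
qed

text \<open>Supplies a second extremal vector as a small perturbation of the first.\<close>

lemma max_add_eq:
  assumes "max (v p) (v r) = n" "v p' < n" "v r' < n"
  shows "max (v (p + p')) (v (r + r')) = n"
proof -
  have "v p = n \<or> v r = n" using assms(1) by (auto simp: max_def split: if_splits)
  hence "v (p + p') = n \<or> v (r + r') = n" using v_add_eq_max[of p' p] v_add_eq_max[of r' r] assms by auto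
  moreover have "v (p + p') \<le> n" "v (r + r') \<le> n"
    using v_add[of p p'] v_add[of r r'] assms by auto
  ultimately show ?thesis by auto
qed

end

subsection \<open>The action of a Moebius transformation\<close>

locale moebius = valued_field v for v :: "'a::field \<Rightarrow> real" +
  fixes a b c e :: 'a
  assumes det: "a * e - b * c \<noteq> 0"
begin

definition vdet :: real where "vdet = v (a * e - b * c)"

definition vmax :: real where "vmax = max (max (v a) (v b)) (max (v c) (v e))"

text \<open>The constant \<open>C\<close> of the overview: \<open>(a, b)\<close> and
  \<open>(c, e)\<close> are the pullbacks of the coordinate forms.\<close>

definition factor :: "('a \<Rightarrow> 'a \<Rightarrow> real) \<Rightarrow> real" where
  "factor N = max (N a b) (N c e)"

definition act :: "('a \<Rightarrow> 'a \<Rightarrow> real) \<Rightarrow> 'a \<Rightarrow> 'a \<Rightarrow> real" where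
  "act N u w = N (u * a + w * c) (u * b + w * e) / factor N"

lemma vdet_pos: "0 < vdet"
  using det by (simp add: vdet_def v_pos)

lemma entries_le: "v a \<le> vmax" "v b \<le> vmax" "v c \<le> vmax" "v e \<le> vmax"
  by (auto simp: vmax_def)

lemma vmax_pos: "0 < vmax"
proof -
  have "a \<noteq> 0 \<or> b \<noteq> 0" using det by auto
  hence "0 < v a \<or> 0 < v b" using v_pos by auto
  thus ?thesis using entries_le by linarith
qed

text \<open>Cramer's rule writes the determinant times a coordinate form as a combination of the
  rows \<open>(a, b)\<close> and \<open>(c, e)\<close>, with entries of the matrix as
  coefficients.\<close>

lemma factor_ge:
  assumes N: "unit_seminorm N"
  shows "vdet \<le> vmax * factor N"
proof -
  have f: "0 \<le> factor N" using unit_nonneg[OF N] by (simp add: factor_def le_max_iff_disj)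
  have bound: "max (v x * N a b) (v y * N c e) \<le> vmax * factor N" if "v x \<le> vmax" "v y \<le> vmax" for x y
    using that vmax_pos unit_nonneg[OF N] by (intro max.boundedI mult_mono) (auto simp: factor_def)
  have "vdet * N 1 0 = N (e * a - b * c) (e * b - b * e)"
    using unit_axes(1)[OF N, of "a * e - b * c"] by (simp add: vdet_def mult.commute)
  also have "\<dots> \<le> max (v e * N a b) (v b * N c e)"
    unfolding unit_scale[OF N, symmetric] by (rule unit_diff[OF N])
  also have "\<dots> \<le> vmax * factor N" by (intro bound entries_le)
  finally have 1: "vdet * N 1 0 \<le> vmax * factor N" .
  have "vdet * N 0 1 = N (c * a - a * c) (c * b - a * e)"
    using unit_axes(2)[OF N, of "c * b - a * e"] v_minus_commute[of "c * b" "a * e"]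
    by (simp add: vdet_def mult.commute)
  also have "\<dots> \<le> max (v c * N a b) (v a * N c e)"
    unfolding unit_scale[OF N, symmetric] by (rule unit_diff[OF N])
  also have "\<dots> \<le> vmax * factor N" by (intro bound entries_le)
  finally have 2: "vdet * N 0 1 \<le> vmax * factor N" .
  from 1 2 unit_max[OF N] show ?thesis by (auto simp: max_def split: if_splits)
qed

lemma factor_pos: "unit_seminorm N \<Longrightarrow> 0 < factor N"
  using factor_ge[of N] vdet_pos vmax_pos by (metis order_less_le_trans zero_less_mult_pos)

lemma unit_act:
  assumes N: "unit_seminorm N"
  shows "unit_seminorm (act N)"
proof -
  note f = factor_pos[OF N]
  show ?thesis unfolding unit_seminorm_def act_def
  proof (intro conjI allI)
    fix k u w u' w'
    show "0 \<le> N (u * a + w * c) (u * b + w * e) / factor N" using f unit_nonneg[OF N] by simp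
    show "N (k * u * a + k * w * c) (k * u * b + k * w * e) / factor N
        = v k * (N (u * a + w * c) (u * b + w * e) / factor N)"
      using unit_scale[OF N, of k "u * a + w * c" "u * b + w * e"] by (simp add: algebra_simps)
    have "N ((u + u') * a + (w + w') * c) ((u + u') * b + (w + w') * e)
        \<le> max (N (u * a + w * c) (u * b + w * e)) (N (u' * a + w' * c) (u' * b + w' * e))"
      using unit_add[OF N, of "u * a + w * c" "u' * a + w' * c" "u * b + w * e" "u' * b + w' * e"]
      by (simp add: algebra_simps)
    thus "N ((u + u') * a + (w + w') * c) ((u + u') * b + (w + w') * e) / factor N
        \<le> max (N (u * a + w * c) (u * b + w * e) / factor N) (N (u' * a + w' * c) (u' * b + w' * e) / factor N)"
      by (rule divide_le_max[OF f])
    have "max (N a b / factor N) (N c e / factor N) = max (N a b) (N c e) / factor N"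
      using f by (simp add: max_divide_distrib_right)
    also have "\<dots> = 1" using f by (simp flip: factor_def)
    finally show "max (N (1 * a + 0 * c) (1 * b + 0 * e) / factor N) (N (0 * a + 1 * c) (0 * b + 1 * e) / factor N) = 1"
      by simp
  qed
qed

text \<open>Solves for the form with prescribed pullback by means of the adjugate; hence every form
  is a pullback.\<close>

lemma preimage_form:
  fixes p r
  defines "u \<equiv> (p * e - r * c) / (a * e - b * c)" and "w \<equiv> (r * a - p * b) / (a * e - b * c)"
  shows "u * a + w * c = p" "u * b + w * e = r"
proof -
  have "u * a + w * c = p * (a * e - b * c) / (a * e - b * c)"
    unfolding u_def w_def by (simp only: times_divide_eq_left add_divide_distrib[symmetric]) (simp add: algebra_simps)
  thus "u * a + w * c = p" using det by simp
  have "u * b + w * e = r * (a * e - b * c) / (a * e - b * c)"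
    unfolding u_def w_def by (simp only: times_divide_eq_left add_divide_distrib[symmetric]) (simp add: algebra_simps)
  thus "u * b + w * e = r" using det by simp
qed

lemma det_act:
  "(u * a + w * c) * (u' * b + w' * e) - (u' * a + w' * c) * (u * b + w * e)
    = (a * e - b * c) * (u * w' - u' * w)"
  by (simp add: algebra_simps)

text \<open>Pullback multiplies the determinant of a pair by \<open>a * e - b * c\<close>, and each
  of the two forms is divided once by \<open>factor N\<close>. Since every pair is a pullback, both
  inequalities hold.\<close>

lemma ndiam_act:
  assumes N: "unit_seminorm N"
  shows "ndiam (act N) = ndiam N * vdet / (factor N)\<^sup>2"
proof -
  note f = factor_pos[OF N]
  have "nvol N * vdet / (factor N)\<^sup>2 \<le> nvol (act N)"
  proof (rule nvol_ge)
    fix u w u' w'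
    have "nvol N * (vdet * v (u * w' - u' * w))
        \<le> N (u * a + w * c) (u * b + w * e) * N (u' * a + w' * c) (u' * b + w' * e)"
      using nvol_le[OF N, of "u * a + w * c" "u' * b + w' * e" "u' * a + w' * c" "u * b + w * e"]
      unfolding det_act v_mult vdet_def .
    thus "nvol N * vdet / (factor N)\<^sup>2 * v (u * w' - u' * w) \<le> act N u w * act N u' w'"
      using f unfolding act_def by (simp add: field_simps power2_eq_square)
  qed
  moreover have "nvol (act N) * (factor N)\<^sup>2 / vdet \<le> nvol N"
  proof (rule nvol_ge)
    fix p r p' r'
    define u w u' w' where "u = (p * e - r * c) / (a * e - b * c)" and "w = (r * a - p * b) / (a * e - b * c)"
      and "u' = (p' * e - r' * c) / (a * e - b * c)" and "w' = (r' * a - p' * b) / (a * e - b * c)"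
    note img = preimage_form[of p r, folded u_def w_def] preimage_form[of p' r', folded u'_def w'_def]
    have d: "v (p * r' - p' * r) = vdet * v (u * w' - u' * w)"
      using arg_cong[OF det_act[of u w u' w'], of v] unfolding img v_mult vdet_def .
    have "nvol (act N) * v (u * w' - u' * w) \<le> (N p r / factor N) * (N p' r' / factor N)"
      using nvol_le[OF unit_act[OF N], of u w' u' w] unfolding act_def img .
    thus "nvol (act N) * (factor N)\<^sup>2 / vdet * v (p * r' - p' * r) \<le> N p r * N p' r'"
      unfolding d using f vdet_pos by (simp add: field_simps power2_eq_square)
  qed
  ultimately show ?thesis
    unfolding nvol_eq_ndiam[OF N] nvol_eq_ndiam[OF unit_act[OF N]]
    using f vdet_pos by (simp add: field_simps)
qed

text \<open>Along the path from \<open>N\<close> to the Gauss point, parametrized by the diameter \<open>t\<close>, the factor is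
  \<open>max (factor N) (t * vmax)\<close>: the image path first ascends towards the Gauss point and, after
  the parameter \<open>factor N / vmax\<close>, descends.\<close>

lemma factor_thicken: "0 \<le> t \<Longrightarrow> factor (thicken N t) = max (factor N) (t * vmax)"
  unfolding factor_def thicken_def vmax_def by (simp add: max_mult_distrib_left max.assoc max.left_commute)

section \<open>The Lipschitz bound along paths\<close>

text \<open>Here the factor is constant, so the order survives and the distance is a difference of
  diameters scaled by \<open>vdet / (factor N)\<^sup>2\<close>; \<open>factor_ge\<close> bounds this
  slope.\<close>

lemma act_lipschitz_ascending:
  assumes N: "unit_seminorm N" and M: "unit_seminorm M" and le: "\<And>u w. N u w \<le> M u w"
    and asc: "ndiam M * vmax \<le> factor N"
  shows "ndist (act N) (act M) \<le> vmax\<^sup>2 / vdet * (ndiam M - ndiam N)"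
proof -
  note f = factor_pos[OF N]
  have fM: "factor M = factor N"
    using eq_thicken[OF N M le] factor_thicken[OF ndiam_nonneg[OF M], of N] asc by simp
  have "act N u w \<le> act M u w" for u w
    unfolding act_def fM using f le by (simp add: divide_right_mono)
  hence "ndist (act N) (act M) = vdet / (factor N)\<^sup>2 * (ndiam M - ndiam N)"
    by (simp add: ndist_comparable ndiam_act[OF N] ndiam_act[OF M] fM algebra_simps diff_divide_distrib)
  also have "\<dots> \<le> vmax\<^sup>2 / vdet * (ndiam M - ndiam N)"
  proof (rule mult_right_mono)
    have "vdet\<^sup>2 \<le> (vmax * factor N)\<^sup>2" using factor_ge[OF N] vdet_pos by (intro power_mono) auto
    thus "vdet / (factor N)\<^sup>2 \<le> vmax\<^sup>2 / vdet"
      using f vdet_pos by (simp add: field_simps power2_eq_square)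
    show "0 \<le> ndiam M - ndiam N" using ndiam_mono[OF N le] by simp
  qed
  finally show ?thesis .
qed

text \<open>The path is cut at its turning point \<open>W\<close>. Beyond it the image of the point
  of diameter \<open>t\<close> has diameter \<open>vdet / (vmax\<^sup>2 * t)\<close>, whose slope is
  controlled because the cut satisfies \<open>t0 \<ge> vdet / vmax\<^sup>2\<close>.\<close>

lemma act_lipschitz_comparable:
  assumes N: "unit_seminorm N" and M: "unit_seminorm M" and le: "\<And>u w. N u w \<le> M u w"
  shows "ndist (act N) (act M) \<le> vmax\<^sup>2 / vdet * (ndiam M - ndiam N)"
proof (cases "ndiam M * vmax \<le> factor N")
  case True
  thus ?thesis by (rule act_lipschitz_ascending[OF N M le])
next
  case False
  note f = factor_pos[OF N]
  define t where "t = ndiam M"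
  \<comment> \<open>The diameter at which the two terms in \<open>factor_thicken\<close>
    balance.\<close>
  define t0 where "t0 = factor N / vmax"
  define W where "W = thicken N t0"
  have t0: "0 < t0" using f vmax_pos by (simp add: t0_def)
  have tt: "t0 < t" using False vmax_pos by (simp add: t0_def t_def field_simps)
  have t1: "t \<le> 1" unfolding t_def by (rule ndiam_le_1[OF M])
  have W: "unit_seminorm W" unfolding W_def using t0 tt t1 by (intro unit_seminorm_thicken[OF N]) auto
  have "ndiam N * max (v a) (v b) \<le> factor N" "ndiam N * max (v c) (v e) \<le> factor N"
    using ndiam_mult_le[OF N, of a b] ndiam_mult_le[OF N, of c e] by (auto simp: factor_def)
  hence "ndiam N * vmax \<le> factor N" by (auto simp: vmax_def max_def)
  hence "ndiam N \<le> t0" using vmax_pos by (simp add: t0_def field_simps)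
  hence dW: "ndiam W = t0" unfolding W_def using t0 tt t1 by (subst ndiam_thicken[OF N]) auto
  have fW: "factor W = t0 * vmax"
    unfolding W_def using t0 vmax_pos by (simp add: factor_thicken t0_def)
  have MT: "M = thicken N t" unfolding t_def by (rule eq_thicken[OF N M le])
  have fM: "factor M = t * vmax"
    using False t0 tt factor_thicken[of t N] unfolding t_def[symmetric] MT[symmetric] by simp
  have NW: "ndist (act N) (act W) \<le> vmax\<^sup>2 / vdet * (t0 - ndiam N)"
    using act_lipschitz_ascending[OF N W] vmax_pos unfolding dW by (simp add: W_def thicken_def t0_def)
  \<comment> \<open>Past the turning point the factor is \<open>t * vmax\<close>, and
    \<open>max n (t * m) / t\<close> does not increase with \<open>t\<close>, so the order is
    reversed.\<close>
  have "act M u w \<le> act W u w" for u w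
  proof -
    define n m where "n = N (u * a + w * c) (u * b + w * e)"
      and "m = max (v (u * a + w * c)) (v (u * b + w * e))"
    have n: "0 \<le> n" unfolding n_def by (rule unit_nonneg[OF N])
    have "max n (t * m) / t = max (n / t) m"
      using tt t0 by (simp add: max_divide_distrib_right)
    also have "\<dots> \<le> max (n / t0) m" using n tt t0 by (intro max.mono divide_left_mono) auto
    also have "\<dots> = max n (t0 * m) / t0" using t0 by (simp add: max_divide_distrib_right)
    finally have "max n (t * m) / t / vmax \<le> max n (t0 * m) / t0 / vmax"
      using vmax_pos by (simp only: divide_right_mono less_imp_le)
    thus ?thesis unfolding act_def fM fW unfolding MT W_def thicken_def n_def[symmetric] m_def[symmetric]
      by (simp add: divide_divide_eq_left)
  qed
  hence "ndist (act W) (act M) = ndiam (act W) - ndiam (act M)"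
    unfolding ndist_commute[of "act W"] by (rule ndist_comparable)
  also have "\<dots> = vdet / vmax\<^sup>2 * (1 / t0 - 1 / t)"
    unfolding ndiam_act[OF W] ndiam_act[OF M] dW t_def[symmetric] fW fM
    using t0 tt vmax_pos by (simp add: field_simps power2_eq_square)
  also have "\<dots> = vdet / vmax\<^sup>2 / (t0 * t) * (t - t0)"
    using t0 tt by (simp add: field_simps)
  also have "\<dots> \<le> vmax\<^sup>2 / vdet * (t - t0)"
  proof (rule mult_right_mono)
    have q: "vdet / vmax\<^sup>2 \<le> t0"
      using factor_ge[OF N] vmax_pos by (simp add: t0_def field_simps power2_eq_square)
    have "vdet / vmax\<^sup>2 * (vdet / vmax\<^sup>2) \<le> t0 * t"
      using q tt t0 vdet_pos vmax_pos by (intro mult_mono) auto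
    thus "vdet / vmax\<^sup>2 / (t0 * t) \<le> vmax\<^sup>2 / vdet"
      using t0 tt vdet_pos vmax_pos by (simp add: field_simps)
  qed (use tt in simp)
  finally have WM: "ndist (act W) (act M) \<le> vmax\<^sup>2 / vdet * (t - t0)" .
  have "ndist (act N) (act M) \<le> ndist (act N) (act W) + ndist (act W) (act M)"
    by (intro ndist_triangle unit_act N W M)
  also have "\<dots> \<le> vmax\<^sup>2 / vdet * (t0 - ndiam N) + vmax\<^sup>2 / vdet * (t - t0)"
    by (rule add_mono[OF NW WM])
  also have "\<dots> = vmax\<^sup>2 / vdet * (ndiam M - ndiam N)"
    unfolding distrib_left[symmetric] t_def by simp
  finally show ?thesis .
qed

text \<open>The distance is additive through the join, so two comparable pairs and the triangle
  inequality for the images suffice.\<close>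

lemma act_lipschitz:
  assumes N: "unit_seminorm N" and M: "unit_seminorm M"
  shows "ndist (act N) (act M) \<le> vmax\<^sup>2 / vdet * ndist N M"
proof -
  define J where "J = (\<lambda>u w. max (N u w) (M u w))"
  have J: "unit_seminorm J" unfolding J_def by (rule unit_seminorm_sup[OF N M])
  have "ndist (act N) (act M) \<le> ndist (act N) (act J) + ndist (act J) (act M)"
    by (intro ndist_triangle unit_act N M J)
  also have "\<dots> \<le> vmax\<^sup>2 / vdet * (ndiam J - ndiam N) + vmax\<^sup>2 / vdet * (ndiam J - ndiam M)"
    unfolding ndist_commute[of "act J"] using N M J
    by (intro add_mono act_lipschitz_comparable) (auto simp: J_def)
  also have "\<dots> = vmax\<^sup>2 / vdet * ndist N M"
    unfolding ndist_def J_def[symmetric] distrib_left[symmetric] by simp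
  finally show ?thesis .
qed

text \<open>Every form is a pullback, so equal images come from proportional seminorms, and the
  normalization makes these equal.\<close>

lemma act_inject:
  assumes N: "unit_seminorm N" and M: "unit_seminorm M" and eq: "act N = act M"
  shows "N = M"
proof -
  note f = factor_pos[OF N] factor_pos[OF M]
  have scaled: "N p r * factor M = M p r * factor N" for p r
  proof -
    define u w where "u = (p * e - r * c) / (a * e - b * c)" and "w = (r * a - p * b) / (a * e - b * c)"
    have "act N u w = act M u w" using eq by simp
    hence "N p r / factor N = M p r / factor M"
      unfolding act_def preimage_form[of p r, folded u_def w_def] .
    thus ?thesis using f by (simp add: field_simps)
  qed
  have "max (N 1 0) (N 0 1) * factor M = max (M 1 0) (M 0 1) * factor N"
    using f by (simp add: max_mult_distrib_right scaled)
  hence "factor M = factor N" unfolding unit_max[OF N] unit_max[OF M] by simp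
  thus ?thesis using scaled f by (auto simp: fun_eq_iff)
qed

subsection \<open>The action on Berkovich points\<close>

lemma denominator_ne_0: "[:e, c:] \<noteq> 0"
  using det by auto

lemma finite_poles: "finite {x. \<not> c * x + e \<noteq> 0}"
proof -
  have "{x. \<not> c * x + e \<noteq> 0} = {x. poly [:e, c:] x = 0}" by (auto simp: mult.commute add.commute)
  thus ?thesis using poly_roots_finite[OF denominator_ne_0] by simp
qed

text \<open>Away from the pole, \<open>mob_num\<close> is the composition with the denominator
  cleared; algebraic rules for it reduce to this pointwise formula.\<close>

lemma poly_mob_num:
  assumes "c * x + e \<noteq> 0"
  shows "poly (mob_num a b c e f) x = (c * x + e) ^ degree f * poly f ((a * x + b) / (c * x + e))"
proof -
  have "(c * x + e) ^ degree f * poly f ((a * x + b) / (c * x + e))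
      = (\<Sum>i\<le>degree f. coeff f i * ((a * x + b) ^ i * (c * x + e) ^ (degree f - i)))"
    unfolding poly_altdef sum_distrib_left
  proof (rule sum.cong)
    fix i assume "i \<in> {..degree f}"
    hence "(c * x + e) ^ degree f = (c * x + e) ^ i * (c * x + e) ^ (degree f - i)"
      by (simp flip: power_add)
    thus "(c * x + e) ^ degree f * (coeff f i * ((a * x + b) / (c * x + e)) ^ i)
        = coeff f i * ((a * x + b) ^ i * (c * x + e) ^ (degree f - i))"
      using assms by (simp add: power_divide)
  qed simp
  thus ?thesis by (simp add: mob_num_def poly_sum mult.commute[of x] add.commute)
qed

lemma mob_num_mult:
  assumes "f \<noteq> 0" "g \<noteq> 0"
  shows "mob_num a b c e (f * g) = mob_num a b c e f * mob_num a b c e g"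
  by (rule poly_eqI_cofinite[OF finite_poles])
    (simp add: poly_mob_num degree_mult_eq[OF assms] power_add)

text \<open>The degree may drop in a sum, so each numerator is padded to the common denominator
  exponent \<open>n\<close>.\<close>

lemma mob_num_add:
  assumes "degree f \<le> n" "degree g \<le> n"
  shows "mob_num a b c e (f + g) * [:e, c:] ^ (n - degree (f + g))
    = mob_num a b c e f * [:e, c:] ^ (n - degree f) + mob_num a b c e g * [:e, c:] ^ (n - degree g)"
proof (rule poly_eqI_cofinite[OF finite_poles])
  fix x assume x: "c * x + e \<noteq> 0"
  have split: "poly (mob_num a b c e h * [:e, c:] ^ (n - degree h)) x
      = (c * x + e) ^ n * poly h ((a * x + b) / (c * x + e))" if "degree h \<le> n" for h
  proof -
    have "(c * x + e) ^ n = (c * x + e) ^ degree h * (c * x + e) ^ (n - degree h)"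
      using that by (simp flip: power_add)
    thus ?thesis by (simp add: poly_mob_num[OF x] mult.commute[of x] add.commute mult_ac)
  qed
  have "degree (f + g) \<le> n" using assms by (rule degree_add_le)
  thus "poly (mob_num a b c e (f + g) * [:e, c:] ^ (n - degree (f + g))) x
    = poly (mob_num a b c e f * [:e, c:] ^ (n - degree f) + mob_num a b c e g * [:e, c:] ^ (n - degree g)) x"
    using assms unfolding poly_add by (simp only: split poly_add distrib_left)
qed

lemma mob_num_0 [simp]: "mob_num a b c e 0 = 0"
  by (simp add: mob_num_def)

lemma pushforward_seminorm:
  assumes s: "berk_seminorm v s" and \<sigma>: "s [:e, c:] \<noteq> 0"
  shows "berk_seminorm v (\<lambda>f. s (mob_num a b c e f) / s [:e, c:] ^ degree f)"
proof -
  define \<sigma> where "\<sigma> = s [:e, c:]"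
  have pos: "0 < \<sigma>" using \<sigma> seminorm_nonneg[OF s, of "[:e, c:]"] by (simp add: \<sigma>_def)
  let ?q = "\<lambda>f. s (mob_num a b c e f) / \<sigma> ^ degree f"
  have "?q (f * g) = ?q f * ?q g" for f g
  proof (cases "f = 0 \<or> g = 0")
    case True
    thus ?thesis by (auto simp: seminorm_0[OF s])
  next
    case False
    thus ?thesis by (simp add: mob_num_mult seminorm_mult[OF s] degree_mult_eq power_add)
  qed
  moreover have "?q (f + g) \<le> ?q f + ?q g" for f g
  proof -
    define n where "n = max (degree f) (degree g)"
    have n: "degree f \<le> n" "degree g \<le> n" by (auto simp: n_def)
    hence n': "degree (f + g) \<le> n" by (rule degree_add_le)
    have q: "?q h = s (mob_num a b c e h * [:e, c:] ^ (n - degree h)) / \<sigma> ^ n" if "degree h \<le> n" for h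
    proof -
      have "\<sigma> ^ n = \<sigma> ^ degree h * \<sigma> ^ (n - degree h)" using that by (simp flip: power_add)
      thus ?thesis using pos by (simp add: seminorm_mult[OF s] seminorm_power[OF s] \<sigma>_def[symmetric])
    qed
    show ?thesis unfolding q[OF n(1)] q[OF n(2)] q[OF n'] mob_num_add[OF n] add_divide_distrib[symmetric]
      using pos seminorm_triangle[OF s] by (intro divide_right_mono) auto
  qed
  moreover have "?q [:k:] = v k" for k
    by (simp add: mob_num_def seminorm_const[OF s])
  moreover have "0 \<le> ?q f" for f using pos seminorm_nonneg[OF s] by simp
  ultimately show ?thesis unfolding berk_seminorm_def \<sigma>_def by blast
qed

lemma mob_berk_mem:
  assumes "x \<in> P1Berk v"
  shows "mob_berk v a b c e x \<in> P1Berk v"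
proof (cases x)
  case (BFin s)
  thus ?thesis using assms pushforward_seminorm[of s] by simp
next
  case BInf
  thus ?thesis using typeI_mem[of "Some (a / c)"] by simp
qed

text \<open>Composition sends \<open>uX + wY\<close> to \<open>u(aX + bY) + w(cX + eY)\<close>; what
  remains is to match the rescalings, separately when the image or the point itself is
  infinity.\<close>

lemma linorm_mob_berk:
  assumes x: "x \<in> P1Berk v"
  shows "linorm (mob_berk v a b c e x) = act (linorm x)"
proof (intro ext)
  fix u w
  show "linorm (mob_berk v a b c e x) u w = act (linorm x) u w"
  proof (cases x)
    case (BFin s)
    hence s: "berk_seminorm v s" using x by simp
    define m where "m = max 1 (s [:0, 1:])"
    have m: "0 < m" by (simp add: m_def)
    have lx: "linorm x p r = s [:r, p:] / m" for p r by (simp add: BFin m_def)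
    have f: "factor (linorm x) = max (s [:b, a:]) (s [:e, c:]) / m"
      unfolding factor_def lx using m by (simp add: max_divide_distrib_right)
    have ax: "act (linorm x) u w = s [:u * b + w * e, u * a + w * c:] / max (s [:b, a:]) (s [:e, c:])"
      unfolding act_def f lx using m by simp
    have comb: "[:u * b + w * e, u * a + w * c:] = smult u [:b, a:] + smult w [:e, c:]" by simp
    show ?thesis
    proof (cases "s [:e, c:] = 0")
      \<comment> \<open>The point is the pole: the multiple of \<open>cT + e\<close> has value 0, so
        adding it changes no value.\<close>
      case True
      have ba: "0 < s [:b, a:]"
        using factor_pos[OF unit_linorm[OF x]] m True unfolding f by (simp add: zero_less_divide_iff)
      have "s (smult u [:b, a:] + smult w [:e, c:]) \<le> max (v u * s [:b, a:]) 0"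
        using seminorm_ultra[OF s, of "smult u [:b, a:]" "smult w [:e, c:]"] True
        unfolding seminorm_smult[OF s] by simp
      moreover have "v u * s [:b, a:] \<le> max (s (smult u [:b, a:] + smult w [:e, c:])) 0"
        using seminorm_ultra[OF s, of "smult u [:b, a:] + smult w [:e, c:]" "smult (- w) [:e, c:]"] True
          seminorm_smult[OF s, of u "[:b, a:]"] seminorm_smult[OF s, of "- w" "[:e, c:]"] by simp
      ultimately have "s [:u * b + w * e, u * a + w * c:] = v u * s [:b, a:]"
        unfolding comb using ba seminorm_nonneg[OF s, of "smult u [:b, a:] + smult w [:e, c:]"]
        by (simp add: max_absorb1)
      thus ?thesis unfolding ax using True ba by (simp add: BFin)
    next
      case False
      define \<sigma> where "\<sigma> = s [:e, c:]"
      have \<sigma>: "0 < \<sigma>" using False seminorm_nonneg[OF s, of "[:e, c:]"] by (simp add: \<sigma>_def)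
      have q: "s (mob_num a b c e [:w, u:]) / \<sigma> ^ degree [:w, u:] = s [:u * b + w * e, u * a + w * c:] / \<sigma>" for u w
      proof (cases "u = 0")
        case True
        have "s [:w * e, w * c:] = v w * \<sigma>" using seminorm_smult[OF s, of w "[:e, c:]"] by (simp add: \<sigma>_def)
        thus ?thesis using True \<sigma> by (simp add: mob_num_def seminorm_const[OF s])
      next
        case False
        thus ?thesis by (simp add: mob_num_def add.commute)
      qed
      have "linorm (mob_berk v a b c e x) u w
          = s [:u * b + w * e, u * a + w * c:] / \<sigma> / max 1 (s [:1 * b + 0 * e, 1 * a + 0 * c:] / \<sigma>)"
        unfolding BFin mob_berk.simps if_not_P[OF False] linorm.simps
        unfolding \<sigma>_def[symmetric] q ..
      also have "max 1 (s [:1 * b + 0 * e, 1 * a + 0 * c:] / \<sigma>) = max (s [:b, a:]) \<sigma> / \<sigma>"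
        using \<sigma> by (simp add: max_divide_distrib_right max.commute)
      finally show ?thesis unfolding ax \<sigma>_def[symmetric] using \<sigma> by simp
    qed
  next
    case BInf
    show ?thesis
    proof (cases "c = 0")
      case True
      hence "a \<noteq> 0" using det by simp
      thus ?thesis unfolding BInf act_def factor_def using True by (simp add: v_mult)
    next
      case False
      have ev: "poly [:w, u:] (a / c) = (u * a + w * c) / c" "poly [:0, 1:] (a / c) = a / c"
        using False by (simp_all add: add_divide_distrib)
      have "linorm (mob_berk v a b c e x) u w = v ((u * a + w * c) / c) / max 1 (v (a / c))"
        unfolding BInf mob_berk.simps if_not_P[OF False] linorm.simps ev ..
      also have "\<dots> = v (u * a + w * c) / max (v a) (v c)"
        unfolding max_1_divide[OF False] using False by (simp add: v_divide)
      also have "\<dots> = act (linorm x) u w" unfolding BInf act_def factor_def linorm.simps ..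
      finally show ?thesis .
    qed
  qed
qed

section \<open>Distortion of the spherical metric\<close>

lemma mob_proj:
  assumes "0 < max (v p) (v r)"
  shows "mob a b c e (proj p r) = proj (a * p + b * r) (c * p + e * r)"
proof (cases "r = 0")
  case True
  hence "p \<noteq> 0" using assms by auto
  thus ?thesis using True by (simp add: proj_def)
next
  case False
  have 1: "c * (p / r) + e = (c * p + e * r) / r" "a * (p / r) + b = (a * p + b * r) / r"
    using False by (simp_all add: field_simps)
  thus ?thesis using False by (simp add: proj_def)
qed

text \<open>The adjugate sends the image vector to the determinant times the original one, and its
  entries are those of the matrix up to sign.\<close>

lemma vector_norm_ge: "vdet * max (v p) (v r) \<le> vmax * max (v (a * p + b * r)) (v (c * p + e * r))"
proof -
  let ?B = "max (v (a * p + b * r)) (v (c * p + e * r))"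
  have bound: "max (v x * v (a * p + b * r)) (v y * v (c * p + e * r)) \<le> vmax * ?B"
    if "v x \<le> vmax" "v y \<le> vmax" for x y
    using that vmax_pos by (intro max.boundedI mult_mono) auto
  have "(a * e - b * c) * p = e * (a * p + b * r) - b * (c * p + e * r)"
    "(a * e - b * c) * r = a * (c * p + e * r) - c * (a * p + b * r)"
    by (simp_all add: algebra_simps)
  hence "vdet * v p \<le> max (v e * v (a * p + b * r)) (v b * v (c * p + e * r))"
    "vdet * v r \<le> max (v a * v (c * p + e * r)) (v c * v (a * p + b * r))"
    unfolding vdet_def using v_diff by (metis v_mult)+
  hence "vdet * v p \<le> vmax * ?B" "vdet * v r \<le> vmax * ?B"
    using bound[of e b] bound[of c a] entries_le by (auto simp: max.commute)
  thus ?thesis using vdet_pos by (simp add: max_mult_distrib_left[of vdet])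
qed

lemma chordal_mob:
  assumes x: "0 < max (v p) (v r)" and y: "0 < max (v p') (v r')"
  shows "0 < max (v (a * p + b * r)) (v (c * p + e * r))"
    and "chordal v (mob a b c e (proj p r)) (mob a b c e (proj p' r')) =
      vdet * v (p * r' - p' * r) / (max (v (a * p + b * r)) (v (c * p + e * r))
        * max (v (a * p' + b * r')) (v (c * p' + e * r')))"
proof -
  have pos: "0 < max (v (a * p + b * r)) (v (c * p + e * r))" if "0 < max (v p) (v r)" for p r
    using vector_norm_ge[of p r] that vdet_pos vmax_pos
    by (metis mult_pos_pos order_less_le_trans zero_less_mult_pos)
  show "0 < max (v (a * p + b * r)) (v (c * p + e * r))" by (rule pos[OF x])
  have "(a * p + b * r) * (c * p' + e * r') - (a * p' + b * r') * (c * p + e * r)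
      = (a * e - b * c) * (p * r' - p' * r)" by (simp add: algebra_simps)
  thus "chordal v (mob a b c e (proj p r)) (mob a b c e (proj p' r')) =
      vdet * v (p * r' - p' * r) / (max (v (a * p + b * r)) (v (c * p + e * r))
        * max (v (a * p' + b * r')) (v (c * p' + e * r')))"
    unfolding mob_proj[OF x] mob_proj[OF y] chordal_proj[OF pos[OF x] pos[OF y]]
    by (simp only: v_mult vdet_def)
qed

text \<open>The numerator of the spherical distance scales by \<open>vdet\<close>;
  \<open>vector_norm_ge\<close>, applied once for each point, controls the denominator and produces
  the square.\<close>

lemma chordal_mob_le: "chordal v (mob a b c e x) (mob a b c e y) \<le> vmax\<^sup>2 / vdet * chordal v x y"
proof -
  obtain p r where x: "x = proj p r" and px: "0 < max (v p) (v r)" using ex_proj by blast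
  obtain p' r' where y: "y = proj p' r'" and py: "0 < max (v p') (v r')" using ex_proj by blast
  define X Y X' Y' where "X = max (v p) (v r)" and "Y = max (v p') (v r')"
    and "X' = max (v (a * p + b * r)) (v (c * p + e * r))"
    and "Y' = max (v (a * p' + b * r')) (v (c * p' + e * r'))"
  have pos: "0 < X" "0 < Y" "0 < X'" "0 < Y'"
    using px py chordal_mob(1)[OF px px] chordal_mob(1)[OF py py] by (simp_all add: X_def Y_def X'_def Y'_def)
  have "vdet * X \<le> vmax * X'" "vdet * Y \<le> vmax * Y'"
    unfolding X_def Y_def X'_def Y'_def by (rule vector_norm_ge)+
  hence "(vdet * X) * (vdet * Y) \<le> (vmax * X') * (vmax * Y')"
    by (rule mult_mono) (use pos vdet_pos vmax_pos in auto)
  hence "vdet / (X' * Y') \<le> vmax\<^sup>2 / vdet / (X * Y)"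
    using pos vdet_pos by (simp add: field_simps power2_eq_square)
  hence "v (p * r' - p' * r) * (vdet / (X' * Y')) \<le> v (p * r' - p' * r) * (vmax\<^sup>2 / vdet / (X * Y))"
    by (intro mult_left_mono) auto
  thus ?thesis unfolding x y chordal_mob(2)[OF px py] chordal_proj[OF px py]
      X_def[symmetric] Y_def[symmetric] X'_def[symmetric] Y'_def[symmetric]
    by (simp add: mult_ac)
qed

text \<open>The extremal pair is the image under the adjugate matrix of \<open>(1, 0), (1, t)\<close> or
  \<open>(0, 1), (t, 1)\<close> with \<open>0 < |t| < 1\<close>, whichever the adjugate stretches maximally.\<close>

lemma chordal_mob_attained:
  "\<exists>x y. 0 < chordal v x y \<and> chordal v (mob a b c e x) (mob a b c e y) = vmax\<^sup>2 / vdet * chordal v x y"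
proof -
  obtain t where t: "t \<noteq> 0" "v t < 1" using ex_small by blast
  have small: "v (t * k) < vmax" if "v k \<le> vmax" for k
  proof (cases "k = 0")
    case False
    hence "v t * v k < 1 * v k" using t v_pos[of k] by (intro mult_strict_right_mono) auto
    thus ?thesis using that by (simp add: v_mult)
  qed (use vmax_pos in simp)
  \<comment> \<open>Both vectors attain equality in \<open>vector_norm_ge\<close>: norm
    \<open>vmax\<close> is sent to norm \<open>vdet\<close>.\<close>
  have main: ?thesis
    if n: "max (v p) (v r) = vmax" "max (v p') (v r') = vmax"
      and d: "max (v (a * p + b * r)) (v (c * p + e * r)) = vdet"
        "max (v (a * p' + b * r')) (v (c * p' + e * r')) = vdet"
      and \<delta>: "p * r' - p' * r \<noteq> 0" for p r p' r'
  proof -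
    have pos: "0 < max (v p) (v r)" "0 < max (v p') (v r')" using n vmax_pos by simp_all
    have "0 < v (p * r' - p' * r)" using \<delta> by (rule v_pos)
    thus ?thesis
      using vmax_pos vdet_pos
      by (intro exI[of _ "proj p r"] exI[of _ "proj p' r'"])
        (simp add: chordal_mob(2)[OF pos] chordal_proj[OF pos] n d power2_eq_square)
  qed
  have td: "v (t * (a * e - b * c)) \<le> vdet" unfolding vdet_def v_mult
    using t by (simp add: mult_left_le_one_le)
  \<comment> \<open>The columns of the adjugate are \<open>(e, -c)\<close> and
    \<open>(-b, a)\<close>; one of them contains an entry of maximal absolute value.\<close>
  have "max (v e) (v c) = vmax \<or> max (v b) (v a) = vmax"
    by (auto simp: vmax_def max_def)
  thus ?thesis
  proof
    assume n: "max (v e) (v c) = vmax"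
    have n': "max (v (e + - (t * b))) (v (- c + t * a)) = vmax"
      using n by (intro max_add_eq) (auto simp: small entries_le)
    have 1: "a * (e + - (t * b)) + b * (- c + t * a) = a * e - b * c"
      "c * (e + - (t * b)) + e * (- c + t * a) = t * (a * e - b * c)"
      "a * e + b * (- c) = a * e - b * c" "c * e + e * (- c) = 0"
      "e * (- c + t * a) - (e + - (t * b)) * (- c) = t * (a * e - b * c)"
      by (simp_all add: algebra_simps)
    show ?thesis
      by (rule main[of e "- c" "e + - (t * b)" "- c + t * a"], unfold 1)
        (use n n' td t det vdet_pos in \<open>auto simp: vdet_def\<close>)
  next
    assume n: "max (v b) (v a) = vmax"
    have n': "max (v (- b + t * e)) (v (a + - (t * c))) = vmax"
      using n by (intro max_add_eq) (auto simp: small entries_le)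
    have 1: "a * (- b + t * e) + b * (a + - (t * c)) = t * (a * e - b * c)"
      "c * (- b + t * e) + e * (a + - (t * c)) = a * e - b * c"
      "a * (- b) + b * a = 0" "c * (- b) + e * a = a * e - b * c"
      "(- b) * (a + - (t * c)) - (- b + t * e) * a = - (t * (a * e - b * c))"
      by (simp_all add: algebra_simps)
    show ?thesis
      by (rule main[of "- b" a "- b + t * e" "a + - (t * c)"], unfold 1)
        (use n n' td t det vdet_pos in \<open>auto simp: vdet_def\<close>)
  qed
qed

section \<open>The two Lipschitz constants\<close>

text \<open>The case \<open>d = 0\<close> is covered by the convention \<open>x / 0 = 0\<close>, so
  nonnegative distances are enough to bound the quotients.\<close>

lemma ratio_le: "0 \<le> d \<Longrightarrow> d' \<le> vmax\<^sup>2 / vdet * d \<Longrightarrow> d' / d \<le> vmax\<^sup>2 / vdet"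
  using vdet_pos by (cases "d = 0") (auto simp: pos_divide_le_eq)

lemma chordal_nonneg: "0 \<le> chordal v x y"
  by (cases x; cases y) auto

lemma Lip_P1_eq: "Lip_P1 v a b c e = vmax\<^sup>2 / vdet"
  unfolding Lip_P1_def
proof (rule cSup_eq_maximum)
  obtain x y where xy: "0 < chordal v x y"
      "chordal v (mob a b c e x) (mob a b c e y) = vmax\<^sup>2 / vdet * chordal v x y"
    using chordal_mob_attained by blast
  hence "x \<noteq> y" by (cases x) auto
  moreover have "vmax\<^sup>2 / vdet = chordal v (mob a b c e x) (mob a b c e y) / chordal v x y"
    using xy by simp
  ultimately show "vmax\<^sup>2 / vdet \<in> {chordal v (mob a b c e x) (mob a b c e y) / chordal v x y | x y. x \<noteq> y}"
    by blast
qed (auto intro!: ratio_le chordal_nonneg chordal_mob_le)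

text \<open>Carries the extremal pair from \<open>P\<^sup>1(K)\<close> to the Berkovich line, which
  gives the lower bound there.\<close>

lemma mob_berk_typeI: "mob_berk v a b c e (typeI v x) = typeI v (mob a b c e x)"
proof (rule linorm_inject)
  obtain p r where x: "x = proj p r" and px: "0 < max (v p) (v r)" using ex_proj by blast
  have eq: "(u * a + w * c) * p + (u * b + w * e) * r = u * (a * p + b * r) + w * (c * p + e * r)" for u w
    by (simp add: algebra_simps)
  note pos = chordal_mob(1)[OF px px]
  have "factor (linorm (typeI v x)) = max (v (a * p + b * r)) (v (c * p + e * r)) / max (v p) (v r)"
    unfolding factor_def x linorm_typeI_proj[OF px] using px by (simp add: max_divide_distrib_right)
  hence "act (linorm (typeI v x)) u w = linorm (typeI v (mob a b c e x)) u w" for u w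
    using px unfolding act_def x mob_proj[OF px] linorm_typeI_proj[OF px] linorm_typeI_proj[OF pos] eq by simp
  thus "linorm (mob_berk v a b c e (typeI v x)) = linorm (typeI v (mob a b c e x))"
    unfolding linorm_mob_berk[OF typeI_mem] by (intro ext)
qed (intro mob_berk_mem typeI_mem)+

lemma Lip_Berk_eq: "Lip_Berk v a b c e = vmax\<^sup>2 / vdet"
  unfolding Lip_Berk_def
proof (rule cSup_eq_maximum)
  let ?\<phi> = "mob_berk v a b c e"
  obtain x y where xy: "0 < chordal v x y"
      "chordal v (mob a b c e x) (mob a b c e y) = vmax\<^sup>2 / vdet * chordal v x y"
    using chordal_mob_attained by blast
  have "typeI v x \<noteq> typeI v y"
  proof
    assume "typeI v x = typeI v y"
    hence "2 * chordal v x y = 2 * chordal v x x" by (metis berk_d_typeI)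
    moreover have "chordal v x x = 0" by (cases x) auto
    ultimately show False using xy by simp
  qed
  moreover have "vmax\<^sup>2 / vdet = berk_d v (?\<phi> (typeI v x)) (?\<phi> (typeI v y)) / berk_d v (typeI v x) (typeI v y)"
    unfolding mob_berk_typeI berk_d_typeI using xy by simp
  ultimately show "vmax\<^sup>2 / vdet \<in> {berk_d v (?\<phi> x) (?\<phi> y) / berk_d v x y | x y.
      x \<in> P1Berk v \<and> y \<in> P1Berk v \<and> x \<noteq> y}"
    using typeI_mem by blast
  fix q assume "q \<in> {berk_d v (?\<phi> x) (?\<phi> y) / berk_d v x y | x y. x \<in> P1Berk v \<and> y \<in> P1Berk v \<and> x \<noteq> y}"
  then obtain x y where q: "q = berk_d v (?\<phi> x) (?\<phi> y) / berk_d v x y"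
      and x: "x \<in> P1Berk v" and y: "y \<in> P1Berk v" by blast
  show "q \<le> vmax\<^sup>2 / vdet" unfolding q berk_d_eq[OF x y]
      berk_d_eq[OF mob_berk_mem[OF x] mob_berk_mem[OF y]] linorm_mob_berk[OF x] linorm_mob_berk[OF y]
    by (intro ratio_le ndist_nonneg act_lipschitz unit_linorm x y)
qed

section \<open>Diameters of the image and the preimage of the Gauss point\<close>

lemma GIR_eq: "GIR v a b c e = vdet / vmax\<^sup>2"
proof -
  have "factor (linorm (zetaG v)) = vmax" by (simp add: factor_def linorm_zetaG vmax_def)
  thus ?thesis unfolding GIR_def diamG_eq[OF mob_berk_mem[OF zetaG_mem]] linorm_mob_berk[OF zetaG_mem]
      ndiam_act[OF unit_linorm[OF zetaG_mem]] by (simp add: linorm_zetaG ndiam_std)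
qed

text \<open>Inverting the action shows that \<open>N\<close> is the maximum norm after the adjugate,
  up to scale; normalization then gives \<open>factor N = vdet / vmax\<close>. Since the image has
  diameter 1, \<open>ndiam_act\<close> can be solved for \<open>ndiam N\<close>.\<close>

lemma mob_berk_eq_zetaG:
  assumes x: "x \<in> P1Berk v" and eq: "mob_berk v a b c e x = zetaG v"
  shows "diamG v x = vdet / vmax\<^sup>2"
proof -
  define N where "N = linorm x"
  note N = unit_linorm[OF x, folded N_def]
  note f = factor_pos[OF N]
  have act: "act N = (\<lambda>u w. max (v u) (v w))"
    using linorm_mob_berk[OF x] eq by (simp add: linorm_zetaG N_def)
  have Npr: "N p r * vdet = factor N * max (v (p * e - r * c)) (v (r * a - p * b))" for p r
  proof -
    define u w where "u = (p * e - r * c) / (a * e - b * c)" and "w = (r * a - p * b) / (a * e - b * c)"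
    have "N p r / factor N = max (v u) (v w)"
      using fun_cong[OF fun_cong[OF act, of u], of w] unfolding act_def preimage_form[of p r, folded u_def w_def] .
    also have "\<dots> = max (v (p * e - r * c)) (v (r * a - p * b)) / vdet"
      unfolding u_def w_def v_divide vdet_def[symmetric] using vdet_pos by (simp add: max_divide_distrib_right)
    finally show ?thesis using f vdet_pos by (simp add: field_simps)
  qed
  have "max (N 1 0) (N 0 1) * vdet = max (N 1 0 * vdet) (N 0 1 * vdet)"
    using vdet_pos by (simp add: max_mult_distrib_right)
  also have "\<dots> = factor N * max (max (v e) (v b)) (max (v c) (v a))"
    unfolding Npr using f by (simp add: max_mult_distrib_left)
  also have "max (max (v e) (v b)) (max (v c) (v a)) = vmax"
    by (simp add: vmax_def max.commute max.left_commute)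
  finally have fv: "vdet = factor N * vmax" unfolding unit_max[OF N] by simp
  have "1 = ndiam N * vdet / (factor N)\<^sup>2"
    using ndiam_act[OF N] unfolding act ndiam_std .
  hence "ndiam N * vdet = (factor N)\<^sup>2" using f by (simp add: field_simps)
  also have "\<dots> = vdet * vdet / vmax\<^sup>2" using fv vmax_pos by (simp add: power2_eq_square)
  finally have "ndiam N * vdet = (vdet / vmax\<^sup>2) * vdet" by simp
  hence "ndiam N = vdet / vmax\<^sup>2" using vdet_pos by (simp only: mult_cancel_right less_irrefl) auto
  thus ?thesis unfolding diamG_eq[OF x] N_def .
qed

text \<open>The witness is the maximum norm after the adjugate, divided by \<open>vmax\<close>,
  which is also the largest absolute value of an entry of the adjugate. With this, the infimum in
  \<open>GPR\<close> is over a one-element set.\<close>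

lemma ex_mob_berk_eq_zetaG: "\<exists>x\<in>P1Berk v. mob_berk v a b c e x = zetaG v"
proof -
  define N where "N p r = max (v (p * e - r * c)) (v (r * a - p * b)) / vmax" for p r
  note S = unit_seminorm_std
  have N: "unit_seminorm N" unfolding unit_seminorm_def
  proof (intro conjI allI)
    fix k u w u' w'
    show "0 \<le> N u w" using vmax_pos by (simp add: N_def le_max_iff_disj)
    show "N (k * u) (k * w) = v k * N u w"
      using unit_scale[OF S, of k "u * e - w * c" "w * a - u * b"] by (simp add: N_def algebra_simps)
    show "N (u + u') (w + w') \<le> max (N u w) (N u' w')" unfolding N_def
      using unit_add[OF S, of "u * e - w * c" "u' * e - w' * c" "w * a - u * b" "w' * a - u' * b"]
      by (intro divide_le_max vmax_pos) (simp add: algebra_simps)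
    have "max (N 1 0) (N 0 1) = max (max (v e) (v b)) (max (v c) (v a)) / vmax"
      using vmax_pos by (simp add: N_def max_divide_distrib_right)
    also have "max (max (v e) (v b)) (max (v c) (v a)) = vmax"
      by (simp add: vmax_def max.commute max.left_commute)
    finally show "max (N 1 0) (N 0 1) = 1" using vmax_pos by simp
  qed
  have Nact: "N (u * a + w * c) (u * b + w * e) = vdet * max (v u) (v w) / vmax" for u w
  proof -
    have "(u * a + w * c) * e - (u * b + w * e) * c = (a * e - b * c) * u"
      "(u * b + w * e) * a - (u * a + w * c) * b = (a * e - b * c) * w"
      by (simp_all add: algebra_simps)
    thus ?thesis unfolding N_def using vdet_pos
      by (simp add: v_mult vdet_def[symmetric] max_mult_distrib_left)
  qed
  have "factor N = vdet / vmax"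
    using Nact[of 1 0] Nact[of 0 1] by (simp add: factor_def)
  hence act: "act N = (\<lambda>u w. max (v u) (v w))"
    using vdet_pos vmax_pos by (simp add: act_def Nact fun_eq_iff)
  obtain x where x: "x \<in> P1Berk v" "linorm x = N" using linorm_surj[OF N] by blast
  hence "mob_berk v a b c e x = zetaG v"
    by (intro linorm_inject mob_berk_mem zetaG_mem) (simp_all add: linorm_mob_berk act linorm_zetaG)
  thus ?thesis using x by blast
qed

lemma GPR_eq: "GPR v a b c e = vdet / vmax\<^sup>2"
proof -
  have "{diamG v x | x. x \<in> P1Berk v \<and> mob_berk v a b c e x = zetaG v} = {vdet / vmax\<^sup>2}"
    (is "?S = _")
  proof (rule equalityI)
    show "?S \<subseteq> {vdet / vmax\<^sup>2}" using mob_berk_eq_zetaG by blast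
    obtain x where "x \<in> P1Berk v" "mob_berk v a b c e x = zetaG v"
      using ex_mob_berk_eq_zetaG by blast
    thus "{vdet / vmax\<^sup>2} \<subseteq> ?S" using mob_berk_eq_zetaG[of x] by (auto intro!: exI[of _ x])
  qed
  thus ?thesis by (simp add: GPR_def)
qed

section \<open>Open balls and \<open>B\<^sub>0\<close>\<close>

lemma B0_eq: "B0 v a b c e = 1"
  unfolding B0_def
proof (rule cSup_eq_maximum)
  \<comment> \<open>This holds whatever \<open>Qpt\<close> denotes: the segment from the Gauss point
    to itself contains no other point.\<close>
  have "zetaG v \<notin> Bminus_lt v p r" for p r
  proof
    assume z: "zetaG v \<in> Bminus_lt v p r"
    define Q where "Q = Qpt v p r"
    have "Q \<in> seg v (zetaG v) (zetaG v)" "Q \<noteq> zetaG v"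
      using z by (auto simp: Bminus_lt_def Q_def)
    hence Q: "Q \<in> P1Berk v" "\<And>u w. max (v u) (v w) \<le> linorm Q u w"
      unfolding seg_zetaG[OF zetaG_mem] linorm_zetaG by auto
    have "linorm Q = linorm (zetaG v)" unfolding linorm_zetaG
      using Q(2) unit_le[OF unit_linorm[OF Q(1)]] by (intro ext antisym)
    thus False using linorm_inject[OF Q(1) zetaG_mem] \<open>Q \<noteq> zetaG v\<close> by simp
  qed
  hence z: "zetaG v \<notin> Bminus v p 1" for p by (auto simp: Bminus_def)
  have "mob_berk v a b c e ` Bminus v p 1 \<noteq> P1Berk v" for p
  proof
    assume "mob_berk v a b c e ` Bminus v p 1 = P1Berk v"
    hence "mob_berk v a b c e (zetaG v) \<in> mob_berk v a b c e ` Bminus v p 1"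
      using mob_berk_mem[OF zetaG_mem] by simp
    then obtain x where x: "x \<in> Bminus v p 1" "mob_berk v a b c e (zetaG v) = mob_berk v a b c e x"
      by blast
    have xm: "x \<in> P1Berk v" using x(1) by (auto simp: Bminus_def Bminus_lt_def)
    have "act (linorm (zetaG v)) = act (linorm x)"
      using x(2) linorm_mob_berk[OF xm] linorm_mob_berk[OF zetaG_mem] by simp
    hence "linorm (zetaG v) = linorm x"
      by (rule act_inject[OF unit_linorm[OF zetaG_mem] unit_linorm[OF xm]])
    hence "zetaG v = x" by (rule linorm_inject[OF zetaG_mem xm])
    thus False using x(1) z by simp
  qed
  thus "1 \<in> {r. 0 < r \<and> r \<le> 1 \<and> (\<forall>p. mob_berk v a b c e ` Bminus v p r \<noteq> P1Berk v)}" by simp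
qed auto

section \<open>The resultant of a normalized representation\<close>

text \<open>Division by an entry of absolute value \<open>vmax\<close> makes that entry 1 and all
  others integral. Existence gives meaning to the choice operator in \<open>abs_Res\<close>.\<close>

lemma ex_normalized_rep: "\<exists>r. normalized_rep v a b c e r"
proof -
  obtain k where k: "v k = vmax" "k = a \<or> k = b \<or> k = c \<or> k = e"
  proof -
    have "vmax = v a \<or> vmax = v b \<or> vmax = v c \<or> vmax = v e" by (simp add: vmax_def max_def)
    thus ?thesis using that by metis
  qed
  have k0: "k \<noteq> 0" using k vmax_pos by auto
  have m: "mob (a / k) (b / k) (c / k) (e / k) x = mob a b c e x" for x
  proof (cases x)
    case (Some z)
    have "c / k * z + e / k = (c * z + e) / k" "a / k * z + b / k = (a * z + b) / k"
      by (simp_all add: add_divide_distrib)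
    thus ?thesis using k0 Some by simp
  qed (use k0 in simp)
  have "a / k * (e / k) - b / k * (c / k) = (a * e - b * c) / (k * k)" by (simp add: diff_divide_distrib)
  hence "a / k * (e / k) - b / k * (c / k) \<noteq> 0" using det k0 by simp
  moreover have "v (x / k) \<le> 1" if "v x \<le> vmax" for x using that k vmax_pos by (simp add: v_divide)
  moreover have "v (k / k) = 1" using k0 by simp
  ultimately have "normalized_rep v a b c e (a / k, b / k, c / k, e / k)"
    using k(2) entries_le m unfolding normalized_rep_def sylv_res_lin_def by (auto simp: fun_eq_iff)
  thus ?thesis by blast
qed

end

text \<open>The Lipschitz constant on \<open>P\<^sup>1(K)\<close> depends only on the map, so comparing its formula for the
  two representations determines the resultant of a normalized one.\<close>

lemma (in moebius) abs_Res_eq: "abs_Res v a b c e = vdet / vmax\<^sup>2"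
proof -
  define r where "r = (SOME r. normalized_rep v a b c e r)"
  have r: "normalized_rep v a b c e r" unfolding r_def by (rule someI_ex[OF ex_normalized_rep])
  obtain a' b' c' e' where rr: "r = (a', b', c', e')" by (cases r)
  interpret n: moebius v a' b' c' e'
    by unfold_locales (use r rr in \<open>auto simp: normalized_rep_def sylv_res_lin_def\<close>)
  have "mob a' b' c' e' = mob a b c e" using r by (simp add: rr normalized_rep_def)
  hence "n.vmax\<^sup>2 / n.vdet = vmax\<^sup>2 / vdet"
    unfolding Lip_P1_eq[symmetric] n.Lip_P1_eq[symmetric] by (simp add: Lip_P1_def)
  moreover have "n.vmax = 1" using r unfolding n.vmax_def rr normalized_rep_def by auto
  ultimately have "n.vdet = vdet / vmax\<^sup>2"
    using vdet_pos vmax_pos n.vdet_pos by (simp add: field_simps)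
  thus ?thesis by (simp add: abs_Res_def r_def[symmetric] rr sylv_res_lin_def n.vdet_def)
qed

theorem theorem3p1:
  fixes v :: "'a::field \<Rightarrow> real" and a b c e :: 'a
  assumes "valued_field_K v"
    and "a * e - b * c \<noteq> 0"
  shows "B0 v a b c e = 1
    \<and> Lip_Berk v a b c e = Lip_P1 v a b c e
    \<and> Lip_P1 v a b c e = 1 / GIR v a b c e
    \<and> 1 / GIR v a b c e = 1 / GPR v a b c e
    \<and> 1 / GPR v a b c e = 1 / abs_Res v a b c e
    \<and> 1 / abs_Res v a b c e = (max (max (v a) (v b)) (max (v c) (v e)))\<^sup>2 / v (a * e - b * c)"
proof -
  interpret moebius v a b c e using assms by unfold_locales
  show ?thesis
    unfolding B0_eq Lip_Berk_eq Lip_P1_eq GIR_eq GPR_eq abs_Res_eq by (simp add: vmax_def vdet_def)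
qed

end
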